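(* Let $F=\phi(r,u,v)$ be a spherically symmetric Finsler metric in $\mathbb{R}^n$ (that is, on a convex domain $\Omega\subset\mathbb{R}^n$), where $r=|x|$, $u=|y|$, $v=\langle x,y\rangle$. Then $F$ is locally dually flat if and only if the following holds: $$s(\psi_r\psi_s+\psi\psi_{rs})+r(\psi_s^2+\psi\psi_{ss})-2\psi\psi_r=0,$$ where $s:=\frac{v}{u}$ and $\psi(r,s):=\phi\big(r,1,\frac{v}{u}\big)$.
   Context: $|\cdot|$ and $\langle\cdot,\cdot\rangle$ denote the Euclidean norm and inner product on $\mathbb{R}^n$; $x\in\Omega$ is a point and $y$ a nonzero tangent vector at $x$. Subscripts denote partial derivatives, and repeated indices are summed. A Finsler metric on a manifold $M$ is a continuous function $F:TM\to[0,\infty)$ that is $C^\infty$ and positive on the slit tangent bundle $TM_0=TM\setminus\{0\}$, satisfies $F(x,\lambda y)=\lambda F(x,y)$ for $\lambda>0$, and for which the matrix $g_{ij}=\tfrac12[F^2]_{y^iy^j}$ is positive definite on $TM_0$; $(g^{ij})$ is its inverse. The spray coefficients of $F$ in a coordinate system $(x^i)$ (with induced fibre coordinates $y^i$) are $$G^i=\tfrac14 g^{il}\big([F^2]_{x^ky^l}y^k-[F^2]_{x^l}\big).$$ $F$ is spherically symmetric on $\Omega$ if it is invariant under any rotation in $\mathbb{R}^n$; equivalently, there is a positive function $\phi=\phi(r,u,v)$ with $F(x,y)=\phi(|x|,|y|,\langle x,y\rangle)$. By homogeneity, $F(x,y)=|y|\,\psi\big(|x|,\tfrac{\langle x,y\rangle}{|y|}\big)$.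 $F$ is locally dually flat if at any point there is a coordinate system $(x^i)$ in which the spray coefficients have the form $G^i=-\tfrac12 g^{ij}H_{y^j}$, where $H=H(x,y)$ is a $C^\infty$ homogeneous scalar function on $TM_0$.
   Formalization: Dual flatness is taken in the Cartesian coordinates (with arbitrary charts "only if" fails: pull back the Euclidean metric by x -> (1+|x|^2)x); n >= 2, and the equation is required only for |s| < r, where F determines the partial derivatives of psi. *)

theory Defs
  imports "HOL-Analysis.Analysis"
begin

text \<open>Meant for open \<open>S\<close>; there, in finite dimension, it is the usual class of \<open>k\<close> times
  continuously differentiable maps.\<close>

primrec Ck_on :: "nat \<Rightarrow> 'a::real_normed_vector set \<Rightarrow> ('a \<Rightarrow> 'b::real_normed_vector) \<Rightarrow> bool" where
  "Ck_on 0 S f \<longleftrightarrow> continuous_on S f"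
| "Ck_on (Suc k) S f \<longleftrightarrow>
     (\<forall>x\<in>S. f differentiable (at x)) \<and>
     (\<forall>v. Ck_on k S (\<lambda>x. frechet_derivative f (at x) v))"

definition Cinf_on :: "'a::real_normed_vector set \<Rightarrow> ('a \<Rightarrow> 'b::real_normed_vector) \<Rightarrow> bool" where
  "Cinf_on S f \<longleftrightarrow> (\<forall>k. Ck_on k S f)"

text \<open>The tangent bundle of an open \<open>\<Omega> \<subseteq> \<real>\<^sup>n\<close> is \<open>\<Omega> \<times> \<real>\<^sup>n\<close>; functions on it are curried,
  \<open>F x y\<close> with base point \<open>x\<close> and tangent vector \<open>y\<close>.\<close>

definition partial_x :: "'n::finite \<Rightarrow> (real^'n \<Rightarrow> real^'n \<Rightarrow> real) \<Rightarrow> real^'n \<Rightarrow> real^'n \<Rightarrow> real" where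
  "partial_x i F x y = deriv (\<lambda>t. F (x + t *\<^sub>R axis i 1) y) 0"

definition partial_y :: "'n::finite \<Rightarrow> (real^'n \<Rightarrow> real^'n \<Rightarrow> real) \<Rightarrow> real^'n \<Rightarrow> real^'n \<Rightarrow> real" where
  "partial_y i F x y = deriv (\<lambda>t. F x (y + t *\<^sub>R axis i 1)) 0"

definition fundamental_tensor :: "(real^'n::finite \<Rightarrow> real^'n \<Rightarrow> real) \<Rightarrow> real^'n \<Rightarrow> real^'n \<Rightarrow> real^'n^'n" where
  "fundamental_tensor F x y =
     (\<chi> i j. 1/2 * partial_y j (partial_y i (\<lambda>x y. (F x y)\<^sup>2)) x y)"

definition finsler_metric :: "(real^'n::finite) set \<Rightarrow> (real^'n \<Rightarrow> real^'n \<Rightarrow> real) \<Rightarrow> bool" where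
  "finsler_metric \<Omega> F \<longleftrightarrow>
     continuous_on (\<Omega> \<times> UNIV) (\<lambda>(x, y). F x y) \<and>
     (\<forall>x\<in>\<Omega>. \<forall>y. F x y \<ge> 0) \<and>
     Cinf_on (\<Omega> \<times> (UNIV - {0})) (\<lambda>(x, y). F x y) \<and>
     (\<forall>x\<in>\<Omega>. \<forall>y. y \<noteq> 0 \<longrightarrow> F x y > 0) \<and>
     (\<forall>x\<in>\<Omega>. \<forall>y. \<forall>c>0. F x (c *\<^sub>R y) = c * F x y) \<and>
     (\<forall>x\<in>\<Omega>. \<forall>y. y \<noteq> 0 \<longrightarrow>
        (\<forall>w. w \<noteq> 0 \<longrightarrow> w \<bullet> (fundamental_tensor F x y *v w) > 0))"

definition spray_coeff :: "(real^'n::finite \<Rightarrow> real^'n \<Rightarrow> real) \<Rightarrow> 'n \<Rightarrow> real^'n \<Rightarrow> real^'n \<Rightarrow> real" where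
  "spray_coeff F i x y =
     1/4 * (\<Sum>l\<in>UNIV. matrix_inv (fundamental_tensor F x y) $ i $ l *
        ((\<Sum>k\<in>UNIV. partial_y l (partial_x k (\<lambda>x y. (F x y)\<^sup>2)) x y * y $ k)
          - partial_x l (\<lambda>x y. (F x y)\<^sup>2) x y))"

text \<open>The value of \<open>\<phi>\<close> is constrained only at triples \<open>(|x|, |y|, \<langle>x, y\<rangle>)\<close> with \<open>x \<in> \<Omega>\<close>, \<open>y \<noteq> 0\<close>.\<close>

definition spherically_symmetric ::
  "(real^'n::finite) set \<Rightarrow> (real \<Rightarrow> real \<Rightarrow> real \<Rightarrow> real) \<Rightarrow> (real^'n \<Rightarrow> real^'n \<Rightarrow> real) \<Rightarrow> bool" where
  "spherically_symmetric \<Omega> \<phi> F \<longleftrightarrow>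
     (\<forall>x\<in>\<Omega>. \<forall>y. y \<noteq> 0 \<longrightarrow> F x y = \<phi> (norm x) (norm y) (x \<bullet> y))"

text \<open>The coordinate system is the Cartesian one of \<open>\<real>\<^sup>n\<close>, the one in which \<open>|x|\<close>, \<open>|y|\<close> and
  \<open>\<langle>x, y\<rangle>\<close> are formed. Allowing an arbitrary curvilinear chart here would make the
  characterisation by an equation in \<open>|x|\<close> and \<open>\<langle>x, y\<rangle>/|y|\<close> false: the pullback of the Euclidean
  metric under \<open>x \<mapsto> (1 + |x|\<^sup>2) x\<close> is spherically symmetric and has vanishing spray coefficients
  in a suitable chart, but does not satisfy the equation.
  The degree \<open>d\<close> of \<open>H\<close> is left open; unless \<open>H\<close> has vanishing \<open>y\<close>-derivatives it is forced to be 3.\<close>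

definition locally_dually_flat :: "(real^'n::finite) set \<Rightarrow> (real^'n \<Rightarrow> real^'n \<Rightarrow> real) \<Rightarrow> bool" where
  "locally_dually_flat \<Omega> F \<longleftrightarrow>
     (\<forall>p\<in>\<Omega>. \<exists>U. open U \<and> p \<in> U \<and> U \<subseteq> \<Omega> \<and>
       (\<exists>(H :: real^'n \<Rightarrow> real^'n \<Rightarrow> real) (d :: real).
          Cinf_on (U \<times> (UNIV - {0})) (\<lambda>(x, y). H x y) \<and>
          (\<forall>x\<in>U. \<forall>y. y \<noteq> 0 \<longrightarrow> (\<forall>c>0. H x (c *\<^sub>R y) = c powr d * H x y)) \<and>
          (\<forall>x\<in>U. \<forall>y. y \<noteq> 0 \<longrightarrow> (\<forall>i. spray_coeff F i x y =
             - 1/2 * (\<Sum>j\<in>UNIV. matrix_inv (fundamental_tensor F x y) $ i $ j *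
                        partial_y j H x y)))))"

text \<open>Partial derivatives of a function of the two real variables \<open>(r, s)\<close>.\<close>

definition partial_r :: "(real \<Rightarrow> real \<Rightarrow> real) \<Rightarrow> real \<Rightarrow> real \<Rightarrow> real" where
  "partial_r f r s = deriv (\<lambda>r'. f r' s) r"

definition partial_s :: "(real \<Rightarrow> real \<Rightarrow> real) \<Rightarrow> real \<Rightarrow> real \<Rightarrow> real" where
  "partial_s f r s = deriv (\<lambda>s'. f r s') s"

text \<open>To be imposed at \<open>(r, s) = (|x|, \<langle>x, y\<rangle>/|y|)\<close> with \<open>x\<close>, \<open>y\<close> linearly independent, i.e. on the
  interior of the region \<open>|s| \<le> r\<close> on which a metric \<open>|y| \<psi>(|x|, \<langle>x, y\<rangle>/|y|)\<close> determines \<open>\<psi>\<close>;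
  on the boundary, two-sided partial derivatives of \<open>\<psi>\<close> are not determined by the metric.\<close>

definition dual_flatness_equation :: "(real \<Rightarrow> real \<Rightarrow> real) \<Rightarrow> real \<Rightarrow> real \<Rightarrow> bool" where
  "dual_flatness_equation \<psi> r s \<longleftrightarrow>
     s * (partial_r \<psi> r s * partial_s \<psi> r s + \<psi> r s * partial_s (partial_r \<psi>) r s)
     + r * ((partial_s \<psi> r s)\<^sup>2 + \<psi> r s * partial_s (partial_s \<psi>) r s)
     - 2 * \<psi> r s * partial_r \<psi> r s = 0"

end

theory Submission
  imports Defs
begin

text \<open>
  Put \<open>L = F\<^sup>2\<close>. As \<open>(g\<^sub>i\<^sub>j)\<close> is invertible, \<open>F\<close> is dually flat with potential \<open>H\<close> iff
  \<open>L\<^bsub>x^k y^l\<^esub> y^k - L\<^bsub>x^l\<^esub> = - 2 H\<^bsub>y^l\<^esub>\<close>. Contracting with \<open>y^l\<close>, Euler's identity expresses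
  \<open>A = L\<^bsub>x^k\<^esub> y^k\<close> by \<open>H\<close>, and differentiating again leaves \<open>L\<^bsub>x^k y^l\<^esub> y^k = 2 L\<^bsub>x^l\<^esub>\<close>;
  conversely, this equation gives dual flatness with \<open>H = - A / 6\<close>.

  If \<open>F = u \<psi>(r, s)\<close> with \<open>r = |x|\<close>, \<open>u = |y|\<close>, \<open>s = \<langle>x, y\<rangle> / u\<close>, then
  \<open>A = 2 u\<^sup>3 \<psi> (s \<psi>\<^sub>r / r + \<psi>\<^sub>s)\<close>, and \<open>L\<^bsub>x^k y^l\<^esub> y^k - 2 L\<^bsub>x^l\<^esub> = A\<^bsub>y^l\<^esub> - 3 L\<^bsub>x^l\<^esub>\<close> is
  \<open>2 u\<^sup>2 / r (x^l - s y^l / u)\<close> times the left-hand side of the equation for \<open>\<psi>\<close>. The vector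
  \<open>x - s y / u\<close> vanishes only if \<open>x\<close> and \<open>y\<close> are linearly dependent, and such pairs are limits
  of independent ones. The smoothness of \<open>\<psi>\<close> comes from \<open>r \<psi>(r, s) = F(r e, s e + (r\<^sup>2 - s\<^sup>2)\<^bsup>1/2\<^esup> e')\<close>
  for orthonormal \<open>e, e'\<close>.
\<close>

subsection \<open>Smooth functions\<close>

text \<open>\<open>frechet_derivative\<close> chooses one of the derivatives at \<open>x\<close>.
  Functions agreeing near \<open>x\<close> have the same derivatives there, so the choice coincides
  even when none exists.\<close>

lemma frechet_derivative_cong_open:
  assumes "open S" "x \<in> S" "\<And>z. z \<in> S \<Longrightarrow> f z = g z"
  shows "frechet_derivative f (at x) = frechet_derivative g (at x)"
proof -
  have "(f has_derivative D) (at x) \<longleftrightarrow> (g has_derivative D) (at x)" for D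
    using assms by (metis has_derivative_transform_within_open)
  then show ?thesis by (simp add: frechet_derivative_def)
qed

text \<open>\<open>Ck_on\<close> takes full derivatives at points of \<open>S\<close>, so openness
  is what makes it depend on values in \<open>S\<close> only. The closure rules below compute
  derivatives just at points of \<open>S\<close> and rely on this.\<close>

lemma Ck_on_cong:
  assumes "open S" "\<And>z. z \<in> S \<Longrightarrow> f z = g z" "Ck_on k S f"
  shows "Ck_on k S g"
  using assms(2,3)
proof (induction k arbitrary: f g)
  case 0
  then show ?case using continuous_on_cong[of S S f g] by simp
next
  case (Suc k)
  have "g differentiable (at x)" if x: "x \<in> S" for x
  proof -
    have "f differentiable (at x)"
      using Suc.prems(2) x by simp
    then obtain D where "(f has_derivative D) (at x)"
      unfolding differentiable_def ..
    then have "(g has_derivative D) (at x)"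
      using assms(1) x Suc.prems(1) by (rule has_derivative_transform_within_open)
    then show ?thesis by (rule differentiableI)
  qed
  moreover have "Ck_on k S (\<lambda>x. frechet_derivative g (at x) v)" for v
  proof (rule Suc.IH)
    show "frechet_derivative f (at z) v = frechet_derivative g (at z) v" if "z \<in> S" for z
      using frechet_derivative_cong_open[OF assms(1) that Suc.prems(1)] by simp
    show "Ck_on k S (\<lambda>x. frechet_derivative f (at x) v)"
      using Suc.prems(2) by simp
  qed
  ultimately show ?case by simp
qed

lemma Ck_on_SucD:
  "Ck_on (Suc k) S f \<Longrightarrow> Ck_on k S f"
proof (induction k arbitrary: f)
  case 0
  then show ?case
    by (auto intro!: continuous_at_imp_continuous_on differentiable_imp_continuous_within)
next
  case (Suc k)
  then have "\<forall>x\<in>S. f differentiable (at x)"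
    and "Ck_on (Suc k) S (\<lambda>x. frechet_derivative f (at x) v)" for v
    unfolding Ck_on.simps(2)[of "Suc k"] by blast+
  with Suc.IH show ?case unfolding Ck_on.simps(2)[of k] by blast
qed

section \<open>Closure properties of the smoothness classes\<close>

lemma Ck_on_const: "Ck_on k S (\<lambda>x. c)"
  by (induction k arbitrary: c) (auto simp: frechet_derivative_const)

lemma Ck_on_linear:
  assumes "bounded_linear f"
  shows "Ck_on k S f"
proof (cases k)
  case 0
  then show ?thesis using assms by (simp add: linear_continuous_on)
next
  case (Suc j)
  have "frechet_derivative f (at x) = f" for x
    by (rule frechet_derivative_at[symmetric], rule bounded_linear_imp_has_derivative[OF assms])
  moreover have "f differentiable (at x)" for x
    using assms by (simp add: bounded_linear_imp_differentiable)
  ultimately show ?thesis using Suc by (simp add: Ck_on_const)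
qed

lemma Ck_on_add:
  assumes "open S" "Ck_on k S f" "Ck_on k S g"
  shows "Ck_on k S (\<lambda>x. f x + g x)"
  using assms(2,3)
proof (induction k arbitrary: f g)
  case 0
  then show ?case by (simp add: continuous_on_add)
next
  case (Suc k)
  have "Ck_on k S (\<lambda>x. frechet_derivative (\<lambda>x. f x + g x) (at x) v)" for v
  proof (rule Ck_on_cong[OF assms(1)])
    show "Ck_on k S (\<lambda>x. frechet_derivative f (at x) v + frechet_derivative g (at x) v)"
      using Suc by simp
    show "frechet_derivative f (at x) v + frechet_derivative g (at x) v
        = frechet_derivative (\<lambda>x. f x + g x) (at x) v" if "x \<in> S" for x
    proof -
      have "(f has_derivative frechet_derivative f (at x)) (at x)"
        "(g has_derivative frechet_derivative g (at x)) (at x)"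
        using Suc.prems that by (simp_all flip: frechet_derivative_works)
      from frechet_derivative_at[OF has_derivative_add[OF this]] show ?thesis by metis
    qed
  qed
  then show ?case using Suc.prems by simp
qed

lemma Ck_on_mult:
  fixes f g :: "'a::real_normed_vector \<Rightarrow> real"
  assumes "open S" "Ck_on k S f" "Ck_on k S g"
  shows "Ck_on k S (\<lambda>x. f x * g x)"
  using assms(2,3)
proof (induction k arbitrary: f g)
  case 0
  then show ?case by (simp add: continuous_on_mult)
next
  case (Suc k)
  have "Ck_on k S (\<lambda>x. frechet_derivative (\<lambda>x. f x * g x) (at x) v)" for v
  proof (rule Ck_on_cong[OF assms(1)])
    \<comment> \<open>The underived factors are known one order higher than the induction hypothesis
      wants; \<open>Ck_on_SucD\<close> lowers them.\<close>
    show "Ck_on k S (\<lambda>x. f x * frechet_derivative g (at x) v + frechet_derivative f (at x) v * g x)"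
      using Suc.prems Suc.prems[THEN Ck_on_SucD] by (intro Ck_on_add[OF assms(1)] Suc.IH) simp_all
    show "f x * frechet_derivative g (at x) v + frechet_derivative f (at x) v * g x
        = frechet_derivative (\<lambda>x. f x * g x) (at x) v" if "x \<in> S" for x
    proof -
      have "(f has_derivative frechet_derivative f (at x)) (at x)"
        "(g has_derivative frechet_derivative g (at x)) (at x)"
        using Suc.prems that by (simp_all flip: frechet_derivative_works)
      from frechet_derivative_at[OF has_derivative_mult[OF this]] show ?thesis by metis
    qed
  qed
  then show ?case using Suc.prems by simp
qed

lemma Ck_on_subset: "Ck_on k S f \<Longrightarrow> T \<subseteq> S \<Longrightarrow> Ck_on k T f"
proof (induction k arbitrary: f)
  case 0
  then show ?case using continuous_on_subset[of S f T] by simp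
next
  case (Suc k)
  then have "\<forall>v. Ck_on k T (\<lambda>x. frechet_derivative f (at x) v)" by simp
  moreover have "\<forall>x\<in>T. f differentiable (at x)" using Suc.prems by auto
  ultimately show ?case by simp
qed

lemma Cinf_on_subset: "Cinf_on S f \<Longrightarrow> T \<subseteq> S \<Longrightarrow> Cinf_on T f"
  using Ck_on_subset[of _ S f T] by (simp add: Cinf_on_def)

lemma Cinf_onD:
  assumes "Cinf_on S f"
  shows "x \<in> S \<Longrightarrow> f differentiable (at x)"
    and "continuous_on S f"
    and "Cinf_on S (\<lambda>x. frechet_derivative f (at x) v)"
proof -
  have C: "Ck_on k S f" for k
    using assms unfolding Cinf_on_def by blast
  show "x \<in> S \<Longrightarrow> f differentiable (at x)"
    using C[of "Suc 0"] unfolding Ck_on.simps(2) by blast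
  show "continuous_on S f"
    using C[of 0] unfolding Ck_on.simps(1) .
  have "Ck_on k S (\<lambda>x. frechet_derivative f (at x) v)" for k
    using C[of "Suc k"] unfolding Ck_on.simps(2) by blast
  then show "Cinf_on S (\<lambda>x. frechet_derivative f (at x) v)"
    unfolding Cinf_on_def by blast
qed

lemma Cinf_on_cong:
  assumes "open S" "\<And>z. z \<in> S \<Longrightarrow> f z = g z" "Cinf_on S f"
  shows "Cinf_on S g"
  unfolding Cinf_on_def
proof
  fix k
  have "Ck_on k S f" using assms(3) by (simp only: Cinf_on_def)
  with assms(1,2) show "Ck_on k S g" by (rule Ck_on_cong)
qed

lemma Cinf_on_add:
  assumes "open S" "Cinf_on S f" "Cinf_on S g"
  shows "Cinf_on S (\<lambda>x. f x + g x)"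
  unfolding Cinf_on_def
proof
  fix k
  show "Ck_on k S (\<lambda>x. f x + g x)"
    using assms(2,3) by (intro Ck_on_add[OF assms(1)]) (simp_all only: Cinf_on_def)
qed

lemma Cinf_on_mult:
  fixes f g :: "'a::real_normed_vector \<Rightarrow> real"
  assumes "open S" "Cinf_on S f" "Cinf_on S g"
  shows "Cinf_on S (\<lambda>x. f x * g x)"
  unfolding Cinf_on_def
proof
  fix k
  show "Ck_on k S (\<lambda>x. f x * g x)"
    using assms(2,3) by (intro Ck_on_mult[OF assms(1)]) (simp_all only: Cinf_on_def)
qed

lemma Cinf_on_const: "Cinf_on S (\<lambda>x. c)"
  unfolding Cinf_on_def by (intro allI Ck_on_const)

lemma Cinf_on_linear: "bounded_linear f \<Longrightarrow> Cinf_on S f"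
  unfolding Cinf_on_def by (intro allI Ck_on_linear)

lemma Cinf_on_sum:
  assumes "open S" "\<And>i. i \<in> I \<Longrightarrow> Cinf_on S (f i)"
  shows "Cinf_on S (\<lambda>x. \<Sum>i\<in>I. f i x)"
  using assms(2)
proof (induction I rule: infinite_finite_induct)
  case (insert i I)
  then have "Cinf_on S (\<lambda>x. f i x + (\<Sum>i\<in>I. f i x))"
    by (intro Cinf_on_add[OF assms(1)]) blast+
  with insert(1,2) show ?case by simp
qed (simp_all add: Cinf_on_const)

subsection \<open>Partial derivatives on the slit tangent bundle\<close>

lemma open_slit: "open \<Omega> \<Longrightarrow> open (\<Omega> \<times> (UNIV - {0 :: 'a::real_normed_vector}))"
  by (intro open_Times) auto

text \<open>Chain rule along the line through \<open>x\<close> in direction \<open>axis i 1\<close>.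
  It ties \<open>deriv\<close>, unspecified where no derivative exists, to a directional Frechet
  derivative, and in that form smoothness can be iterated.\<close>

lemma partial_x_has_derivative:
  assumes "(\<lambda>(x, y). G x y) differentiable (at (x, y))"
  shows "((\<lambda>t. G (x + t *\<^sub>R axis i 1) y) has_real_derivative partial_x i G x y) (at 0)"
    and "partial_x i G x y = frechet_derivative (\<lambda>(x, y). G x y) (at (x, y)) (axis i 1, 0)"
proof -
  let ?D = "frechet_derivative (\<lambda>(x, y). G x y) (at (x, y))"
  have D: "((\<lambda>(x, y). G x y) has_derivative ?D) (at (x, y))"
    using assms frechet_derivative_works by blast
  have "((\<lambda>t. (x + t *\<^sub>R axis i 1, y)) has_derivative (\<lambda>t. (t *\<^sub>R axis i 1, 0))) (at 0)"
    by (auto intro!: derivative_eq_intros)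
  from has_derivative_compose[OF this, of "\<lambda>(x, y). G x y" ?D]
  have "((\<lambda>t. G (x + t *\<^sub>R axis i 1) y) has_derivative (\<lambda>t. ?D (t *\<^sub>R axis i 1, 0))) (at 0)"
    using D by simp
  moreover have "?D (t *\<^sub>R axis i 1, 0) = ?D (axis i 1, 0) * t" for t
    using linear_cmul[OF has_derivative_linear[OF D], of t "(axis i 1, 0)"] by simp
  ultimately have *: "((\<lambda>t. G (x + t *\<^sub>R axis i 1) y) has_real_derivative ?D (axis i 1, 0)) (at 0)"
    by (simp add: has_field_derivative_def)
  then show "partial_x i G x y = ?D (axis i 1, 0)"
    unfolding partial_x_def by (rule DERIV_imp_deriv)
  with * show "((\<lambda>t. G (x + t *\<^sub>R axis i 1) y) has_real_derivative partial_x i G x y) (at 0)"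
    by simp
qed

text \<open>Only differentiability along the fibre is asked for, so that the result also applies to
  sums and products formed with \<open>x\<close> fixed.\<close>

lemma partial_y_has_derivative:
  assumes "G x differentiable (at y)"
  shows "((\<lambda>t. G x (y + t *\<^sub>R axis i 1)) has_real_derivative partial_y i G x y) (at 0)"
    and "partial_y i G x y = frechet_derivative (G x) (at y) (axis i 1)"
proof -
  let ?D = "frechet_derivative (G x) (at y)"
  have D: "(G x has_derivative ?D) (at y)"
    using assms frechet_derivative_works by blast
  have "((\<lambda>t. y + t *\<^sub>R axis i 1) has_derivative (\<lambda>t. t *\<^sub>R axis i 1)) (at 0)"
    by (auto intro!: derivative_eq_intros)
  from has_derivative_compose[OF this, of "G x" ?D]
  have "((\<lambda>t. G x (y + t *\<^sub>R axis i 1)) has_derivative (\<lambda>t. ?D (t *\<^sub>R axis i 1))) (at 0)"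
    using D by simp
  moreover have "?D (t *\<^sub>R axis i 1) = ?D (axis i 1) * t" for t
    using linear_cmul[OF has_derivative_linear[OF D], of t "axis i 1"] by simp
  ultimately have *: "((\<lambda>t. G x (y + t *\<^sub>R axis i 1)) has_real_derivative ?D (axis i 1)) (at 0)"
    by (simp add: has_field_derivative_def)
  then show "partial_y i G x y = ?D (axis i 1)"
    unfolding partial_y_def by (rule DERIV_imp_deriv)
  with * show "((\<lambda>t. G x (y + t *\<^sub>R axis i 1)) has_real_derivative partial_y i G x y) (at 0)"
    by simp
qed

lemma differentiable_fibre:
  assumes "(\<lambda>(x, y). G x y) differentiable (at (x, y))"
  shows "G x differentiable (at y)"
    and "frechet_derivative (G x) (at y) w = frechet_derivative (\<lambda>(x, y). G x y) (at (x, y)) (0, w)"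
proof -
  let ?D = "frechet_derivative (\<lambda>(x, y). G x y) (at (x, y))"
  have D: "((\<lambda>(x, y). G x y) has_derivative ?D) (at (x, y))"
    using assms frechet_derivative_works by blast
  have "((\<lambda>y. (x, y)) has_derivative (\<lambda>w. (0, w))) (at y)"
    by (auto intro!: derivative_eq_intros)
  from has_derivative_compose[OF this, of "\<lambda>(x, y). G x y" ?D]
  have *: "(G x has_derivative (\<lambda>w. ?D (0, w))) (at y)"
    using D by simp
  show "G x differentiable (at y)" using * by (rule differentiableI)
  show "frechet_derivative (G x) (at y) w = ?D (0, w)"
    unfolding frechet_derivative_at[OF *, symmetric] ..
qed

text \<open>On the slit bundle the partial derivative is the Frechet derivative in a fixed
  direction, and the recursion defining \<open>Ck_on\<close> covers exactly such functions.\<close>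

lemma Cinf_on_partial_x:
  fixes \<Omega> :: "(real^'n::finite) set"
  assumes "open \<Omega>" "Cinf_on (\<Omega> \<times> (UNIV - {0})) (\<lambda>(x, y). G x y)"
  shows "Cinf_on (\<Omega> \<times> (UNIV - {0})) (\<lambda>(x, y). partial_x i G x y)"
proof -
  have "frechet_derivative (\<lambda>(x, y). G x y) (at z) (axis i 1, 0) = (\<lambda>(x, y). partial_x i G x y) z"
    if "z \<in> \<Omega> \<times> (UNIV - {0})" for z
  proof -
    obtain x y where "z = (x, y)" by (cases z)
    with partial_x_has_derivative(2)[of G x y i] Cinf_onD(1)[OF assms(2) that]
    show ?thesis by simp
  qed
  then show ?thesis
    by (rule Cinf_on_cong[OF open_slit[OF assms(1)] _ Cinf_onD(3)[OF assms(2)]])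
qed

lemma Cinf_on_partial_y:
  fixes \<Omega> :: "(real^'n::finite) set"
  assumes "open \<Omega>" "Cinf_on (\<Omega> \<times> (UNIV - {0})) (\<lambda>(x, y). G x y)"
  shows "Cinf_on (\<Omega> \<times> (UNIV - {0})) (\<lambda>(x, y). partial_y i G x y)"
proof -
  have "frechet_derivative (\<lambda>(x, y). G x y) (at z) (0, axis i 1) = (\<lambda>(x, y). partial_y i G x y) z"
    if "z \<in> \<Omega> \<times> (UNIV - {0})" for z
  proof -
    obtain x y where z: "z = (x, y)" by (cases z)
    have diff: "(\<lambda>(x, y). G x y) differentiable (at (x, y))"
      using Cinf_onD(1)[OF assms(2) that] z by simp
    show ?thesis
      using partial_y_has_derivative(2)[where G = G, OF differentiable_fibre(1)[OF diff]]
        differentiable_fibre(2)[OF diff] z by simp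
  qed
  then show ?thesis
    by (rule Cinf_on_cong[OF open_slit[OF assms(1)] _ Cinf_onD(3)[OF assms(2)]])
qed

lemma frechet_derivative_eq_sum_partial_y:
  assumes "G x differentiable (at y)"
  shows "frechet_derivative (G x) (at y) w = (\<Sum>i\<in>UNIV. w $ i * partial_y i G x y)"
proof -
  have lin: "linear (frechet_derivative (G x) (at y))"
    using assms by (rule linear_frechet_derivative)
  have "frechet_derivative (G x) (at y) w
      = frechet_derivative (G x) (at y) (\<Sum>i\<in>UNIV. w $ i *\<^sub>R axis i 1)"
    by (simp add: basis_expansion flip: scalar_mult_eq_scaleR)
  also have "\<dots> = (\<Sum>i\<in>UNIV. w $ i * partial_y i G x y)"
    using partial_y_has_derivative(2)[of G, OF assms]
    by (simp add: linear_sum[OF lin] linear_cmul[OF lin])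
  finally show ?thesis .
qed

text \<open>Differentiate \<open>G x (c *\<^sub>R y)\<close> at \<open>c = 1\<close> in two ways: by
  the chain rule, and as \<open>c powr d * G x y\<close>.\<close>

lemma euler_homogeneous:
  assumes "G x differentiable (at y)" "\<And>c. c > 0 \<Longrightarrow> G x (c *\<^sub>R y) = c powr d * G x y"
  shows "(\<Sum>i\<in>UNIV. y $ i * partial_y i G x y) = d * G x y"
proof -
  let ?D = "frechet_derivative (G x) (at y)"
  have D: "(G x has_derivative ?D) (at (1 *\<^sub>R y))"
    using assms(1) frechet_derivative_works by auto
  have "((\<lambda>c. c *\<^sub>R y) has_derivative (\<lambda>c. c *\<^sub>R y)) (at (1::real))"
    by (auto intro!: derivative_eq_intros)
  from has_derivative_compose[OF this D]
  have 1: "((\<lambda>c. G x (c *\<^sub>R y)) has_derivative (\<lambda>c. ?D (c *\<^sub>R y))) (at 1)" .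
  have "((\<lambda>c. c powr d * G x y) has_real_derivative d * G x y) (at 1)"
    by (auto intro!: derivative_eq_intros)
  then have "((\<lambda>c. G x (c *\<^sub>R y)) has_real_derivative d * G x y) (at 1)"
    by (rule has_field_derivative_transform_within_open[where S = "{0<..}"])
       (auto simp: assms(2))
  then have "(\<lambda>c. ?D (c *\<^sub>R y)) = (*) (d * G x y)"
    unfolding has_field_derivative_def using 1 has_derivative_unique by blast
  then have "?D (1 *\<^sub>R y) = d * G x y * 1" by metis
  then show ?thesis using frechet_derivative_eq_sum_partial_y[of G, OF assms(1)] by simp
qed

text \<open>From \<open>G x (c *\<^sub>R y + t *\<^sub>R axis i 1) = c powr d * G x (y + (t / c)
  *\<^sub>R axis i 1)\<close>, the inner factor \<open>1 / c\<close> lowers the degree by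
  one.\<close>

lemma partial_y_homogeneous:
  assumes diff: "G x differentiable (at y)" and "y \<noteq> 0"
    and hom: "\<And>y c. y \<noteq> 0 \<Longrightarrow> c > 0 \<Longrightarrow> G x (c *\<^sub>R y) = c powr d * G x y" and c: "c > 0"
  shows "partial_y i G x (c *\<^sub>R y) = c powr (d - 1) * partial_y i G x y"
proof -
  have "((\<lambda>t. G x (y + t *\<^sub>R axis i 1)) has_real_derivative partial_y i G x y) (at (0 / c))"
    using partial_y_has_derivative(1)[of G, OF diff] by simp
  moreover have "((\<lambda>t. t / c) has_real_derivative 1 / c) (at 0)"
    by (rule DERIV_cdivide) (rule DERIV_ident)
  ultimately have "((\<lambda>t. G x (y + (t / c) *\<^sub>R axis i 1)) has_real_derivative
      partial_y i G x y * (1 / c)) (at 0)"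
    by (rule DERIV_chain2)
  then have "((\<lambda>t. c powr d * G x (y + (t / c) *\<^sub>R axis i 1)) has_real_derivative
      c powr d * (partial_y i G x y * (1 / c))) (at 0)"
    by (rule DERIV_cmult)
  \<comment> \<open>Homogeneity is assumed off the zero section only, so the two functions of
    \<open>t\<close> are compared on this open set.\<close>
  moreover have "open {t. y + (t / c) *\<^sub>R axis i 1 \<noteq> 0}" (is "open ?T")
    by (intro open_Collect_neq continuous_intros) (use c in simp)
  moreover have "0 \<in> ?T" using \<open>y \<noteq> 0\<close> by simp
  moreover have "c powr d * G x (y + (t / c) *\<^sub>R axis i 1) = G x (c *\<^sub>R y + t *\<^sub>R axis i 1)"
    if "t \<in> {t. y + (t / c) *\<^sub>R axis i 1 \<noteq> 0}" for t
    using hom[of "y + (t / c) *\<^sub>R axis i 1" c] that c by (simp add: scaleR_add_right)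
  ultimately have "((\<lambda>t. G x (c *\<^sub>R y + t *\<^sub>R axis i 1)) has_real_derivative
      c powr d * (partial_y i G x y * (1 / c))) (at 0)"
    by (rule has_field_derivative_transform_within_open)
  then have "partial_y i G x (c *\<^sub>R y) = c powr d * (partial_y i G x y * (1 / c))"
    unfolding partial_y_def by (rule DERIV_imp_deriv)
  also have "\<dots> = c powr (d - 1) * partial_y i G x y"
    using c by (simp add: powr_diff)
  finally show ?thesis .
qed

lemma partial_y_cong:
  assumes "y \<noteq> 0" "\<And>y. y \<noteq> 0 \<Longrightarrow> G x y = K x y"
  shows "partial_y i G x y = partial_y i K x y"
proof -
  have "open {t. y + t *\<^sub>R axis i 1 \<noteq> 0}"
    by (intro open_Collect_neq continuous_intros)
  then have "\<forall>\<^sub>F t in nhds 0. y + t *\<^sub>R axis i 1 \<noteq> 0"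
    using eventually_nhds_in_open[of _ 0] \<open>y \<noteq> 0\<close> by fastforce
  then have "\<forall>\<^sub>F t in nhds 0. G x (y + t *\<^sub>R axis i 1) = K x (y + t *\<^sub>R axis i 1)"
    by eventually_elim (rule assms(2))
  then show ?thesis unfolding partial_y_def by (intro deriv_cong_ev) simp_all
qed

lemma eventually_translate_in_open:
  fixes v :: "'a::real_normed_vector"
  assumes "open U" "x \<in> U"
  shows "\<forall>\<^sub>F t in nhds (0::real). x + t *\<^sub>R v \<in> U"
proof -
  have "open ((\<lambda>t::real. x + t *\<^sub>R v) -` U)"
    using assms(1) by (intro open_vimage continuous_intros)
  then have "\<forall>\<^sub>F t in nhds (0::real). t \<in> (\<lambda>t. x + t *\<^sub>R v) -` U"
    by (rule eventually_nhds_in_open) (simp add: assms(2))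
  then show ?thesis by simp
qed

text \<open>Scaling in the fibre commutes with differentiation in the base, so the degree in
  \<open>y\<close> is preserved, in contrast to \<open>partial_y\<close>.\<close>

lemma partial_x_homogeneous:
  assumes "open U" "x \<in> U" "(\<lambda>(x, y). G x y) differentiable (at (x, y))"
    and hom: "\<And>x. x \<in> U \<Longrightarrow> G x y' = c * G x y"
  shows "partial_x i G x y' = c * partial_x i G x y"
proof -
  have "\<forall>\<^sub>F t in nhds 0. G (x + t *\<^sub>R axis i 1) y' = c * G (x + t *\<^sub>R axis i 1) y"
    using eventually_translate_in_open[OF assms(1,2)] by eventually_elim (rule hom)
  then have "partial_x i G x y' = deriv (\<lambda>t. c * G (x + t *\<^sub>R axis i 1) y) 0"
    unfolding partial_x_def by (intro deriv_cong_ev) simp_all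
  also have "\<dots> = c * partial_x i G x y"
    by (intro DERIV_imp_deriv DERIV_cmult partial_x_has_derivative(1) assms(3))
  finally show ?thesis .
qed

text \<open>Product rule: differentiating the factor \<open>y $ k\<close> leaves only the term
  \<open>k = l\<close>, which yields the extra \<open>M l x y\<close>.\<close>

lemma partial_y_contraction:
  assumes "\<And>k. M k x differentiable (at y)"
  shows "partial_y l (\<lambda>x y. \<Sum>k\<in>UNIV. M k x y * y $ k) x y
    = (\<Sum>k\<in>UNIV. partial_y l (M k) x y * y $ k) + M l x y"
proof -
  have "((\<lambda>t. M k x (y + t *\<^sub>R axis l 1) * (y + t *\<^sub>R axis l 1) $ k) has_real_derivative
      partial_y l (M k) x y * y $ k + (if k = l then M k x y else 0)) (at 0)" for k
  proof -
    have "((\<lambda>t. (y + t *\<^sub>R axis l 1) $ k) has_real_derivative (axis l 1 :: real^'a) $ k) (at 0)"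
      by (auto intro!: derivative_eq_intros)
    from DERIV_mult[OF partial_y_has_derivative(1)[of "M k" x y l, OF assms] this]
    moreover have "(axis l (1::real) :: real^'a) $ k = (if k = l then 1 else 0)"
      by (simp add: axis_def)
    ultimately show ?thesis by (cases "k = l") (simp_all add: mult.commute)
  qed
  then have "((\<lambda>t. \<Sum>k\<in>UNIV. M k x (y + t *\<^sub>R axis l 1) * (y + t *\<^sub>R axis l 1) $ k)
      has_real_derivative
      (\<Sum>k\<in>UNIV. partial_y l (M k) x y * y $ k + (if k = l then M k x y else 0))) (at 0)"
    by (intro DERIV_sum)
  then have "partial_y l (\<lambda>x y. \<Sum>k\<in>UNIV. M k x y * y $ k) x y
      = (\<Sum>k\<in>UNIV. partial_y l (M k) x y * y $ k + (if k = l then M k x y else 0))"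
    unfolding partial_y_def by (rule DERIV_imp_deriv)
  then show ?thesis by (simp add: sum.distrib)
qed

lemma partial_y_cmult:
  assumes "G x differentiable (at y)"
  shows "partial_y i (\<lambda>x y. c * G x y) x y = c * partial_y i G x y"
  unfolding partial_y_def[of i "\<lambda>x y. c * G x y"]
  by (intro DERIV_imp_deriv DERIV_cmult partial_y_has_derivative(1)[of G] assms)

subsection \<open>Dual flatness as an equation for \<open>F\<^sup>2\<close>\<close>

text \<open>Contraction gives \<open>A = - 2 d H\<close>, and differentiating this gives
  \<open>E l + partial_x l L = - 2 d * partial_y l H\<close>. Compared with
  \<open>E l - partial_x l L = - 2 * partial_y l H\<close>, this settles \<open>d = 3\<close>. For
  any other \<open>d\<close> the degrees in \<open>y\<close> are incompatible and both sides of the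
  claim vanish.\<close>

lemma dually_flat_potential_imp:
  fixes L H :: "real^'n::finite \<Rightarrow> real^'n \<Rightarrow> real"
  assumes U: "open U"
    and L: "Cinf_on (U \<times> (UNIV - {0})) (\<lambda>(x, y). L x y)"
    and H: "Cinf_on (U \<times> (UNIV - {0})) (\<lambda>(x, y). H x y)"
    and homL: "\<And>x y c. x \<in> U \<Longrightarrow> y \<noteq> 0 \<Longrightarrow> c > 0 \<Longrightarrow> L x (c *\<^sub>R y) = c powr 2 * L x y"
    and homH: "\<And>x y c. x \<in> U \<Longrightarrow> y \<noteq> 0 \<Longrightarrow> c > 0 \<Longrightarrow> H x (c *\<^sub>R y) = c powr d * H x y"
    and eq: "\<And>x y l. x \<in> U \<Longrightarrow> y \<noteq> 0 \<Longrightarrow>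
      (\<Sum>k\<in>UNIV. partial_y l (partial_x k L) x y * y $ k) - partial_x l L x y
        = - 2 * partial_y l H x y"
    and x: "x \<in> U" and y: "y \<noteq> 0"
  shows "(\<Sum>k\<in>UNIV. partial_y l (partial_x k L) x y * y $ k) = 2 * partial_x l L x y"
proof -
  define A where "A = (\<lambda>x y. \<Sum>k\<in>UNIV. partial_x k L x y * y $ k)"
  define E where "E l y = (\<Sum>k\<in>UNIV. partial_y l (partial_x k L) x y * y $ k)" for l y
  have in_slit: "(x, y) \<in> U \<times> (UNIV - {0})" if "y \<noteq> 0" for y
    using x that by simp
  have diffL: "(\<lambda>(x, y). L x y) differentiable (at (x, y))" if "y \<noteq> 0" for y
    by (rule Cinf_onD(1)[OF L in_slit[OF that]])
  have diffH: "H x differentiable (at y)" if "y \<noteq> 0" for y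
    by (rule differentiable_fibre(1)[OF Cinf_onD(1)[OF H in_slit[OF that]]])
  have diffM: "partial_x k L x differentiable (at y)" if "y \<noteq> 0" for k y
    by (rule differentiable_fibre(1)[OF Cinf_onD(1)[OF Cinf_on_partial_x[OF U L] in_slit[OF that]]])
  have homM: "partial_x k L x (c *\<^sub>R y) = c powr 2 * partial_x k L x y"
    if "y \<noteq> 0" "c > 0" for k y c
    by (rule partial_x_homogeneous[OF U x diffL[OF that(1)]]) (rule homL[OF _ that])
  have A_y: "partial_y l A x y = E l y + partial_x l L x y" if "y \<noteq> 0" for l y
    unfolding A_def E_def by (rule partial_y_contraction) (rule diffM[OF that])
  \<comment> \<open>Each \<open>partial_x k L\<close> has degree 2 in \<open>y\<close>, so by
    Euler's identity the first term contracts to \<open>2 * A x y\<close>; the second takes one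
    \<open>A x y\<close> away.\<close>
  have "(\<Sum>l\<in>UNIV. y $ l * (E l y - partial_x l L x y)) = A x y" if "y \<noteq> 0" for y
  proof -
    have "(\<Sum>l\<in>UNIV. y $ l * E l y)
        = (\<Sum>k\<in>UNIV. (\<Sum>l\<in>UNIV. y $ l * partial_y l (partial_x k L) x y) * y $ k)"
      unfolding E_def sum_distrib_left sum_distrib_right
      by (subst sum.swap) (simp add: mult.assoc)
    also have "\<dots> = (\<Sum>k\<in>UNIV. 2 * partial_x k L x y * y $ k)"
      by (simp add: euler_homogeneous[of "partial_x _ L" x y 2, OF diffM[OF that] homM[OF that]])
    also have "\<dots> = 2 * A x y"
      by (simp add: A_def sum_distrib_left mult.assoc)
    finally show ?thesis
      by (simp add: A_def right_diff_distrib sum_subtractf mult.commute)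
  qed
  moreover have "(\<Sum>l\<in>UNIV. y $ l * (E l y - partial_x l L x y)) = - 2 * d * H x y"
    if "y \<noteq> 0" for y
  proof -
    have "(\<Sum>l\<in>UNIV. y $ l * (E l y - partial_x l L x y))
        = - 2 * (\<Sum>l\<in>UNIV. y $ l * partial_y l H x y)"
      unfolding E_def eq[OF x that] sum_distrib_left by (simp add: algebra_simps)
    then show ?thesis
      using euler_homogeneous[of H x y d, OF diffH[OF that] homH[OF x that]] by simp
  qed
  ultimately have A_H: "A x y = (- 2 * d) * H x y" if "y \<noteq> 0" for y
    using that by metis
  then have "partial_y l A x y = partial_y l (\<lambda>x y. (- 2 * d) * H x y) x y"
    by (intro partial_y_cong[OF y])
  also have "\<dots> = (- 2 * d) * partial_y l H x y"
    by (rule partial_y_cmult[of H, OF diffH[OF y]])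
  finally have 1: "E l y + partial_x l L x y = - 2 * d * partial_y l H x y"
    using A_y[OF y] by simp
  have 2: "E l y - partial_x l L x y = - 2 * partial_y l H x y"
    using eq[OF x y] by (simp add: E_def)
  show ?thesis
  proof (cases "d = 3")
    case True
    with 1 2 show ?thesis by (simp add: E_def)
  next
    case False
    \<comment> \<open>\<open>A\<close> has degree 3 in \<open>y\<close>, but \<open>A = - 2 d H\<close> has degree \<open>d\<close>.\<close>
    have "A x y = 0" if "y \<noteq> 0" for y
    proof -
      have "2 powr 3 * A x y = A x (2 *\<^sub>R y)"
        using homM[OF that, of 2]
        by (simp add: A_def sum_distrib_left mult.assoc mult.left_commute)
      also have "\<dots> = 2 powr d * A x y"
        using A_H[OF that] A_H[of "2 *\<^sub>R y"] homH[OF x that, of 2] that by simp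
      finally have "(2 powr 3 - 2 powr d) * A x y = 0"
        by (simp only: left_diff_distrib)
      moreover have "2 powr 3 \<noteq> (2 powr d :: real)"
        using False by (subst powr_inj) auto
      ultimately show ?thesis by (simp only: mult_eq_0_iff right_minus_eq) blast
    qed
    \<comment> \<open>The zero function is written as \<open>0 * H x y\<close> so that
      \<open>partial_y_cmult\<close> evaluates its derivative.\<close>
    then have "partial_y l A x y = partial_y l (\<lambda>x y. 0 * H x y) x y"
      by (intro partial_y_cong[OF y]) simp
    then have 3: "E l y = - partial_x l L x y"
      using A_y[OF y] partial_y_cmult[of H x y l 0, OF diffH[OF y]] by simp
    \<comment> \<open>With \<open>E l = - partial_x l L\<close> the potential equation reads
      \<open>partial_x l L = partial_y l H\<close>. The degrees 2 and \<open>d - 1\<close> of the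
      two sides differ, so comparing \<open>y\<close> with \<open>2 *\<^sub>R y\<close> forces them
      to vanish.\<close>
    have "2 powr 2 * partial_x l L x y = partial_x l L x (2 *\<^sub>R y)"
      using homM[OF y, of 2] by simp
    also have "\<dots> = partial_y l H x (2 *\<^sub>R y)"
    proof -
      have "2 *\<^sub>R y \<noteq> 0" using y by simp
      have "partial_y l A x (2 *\<^sub>R y) = partial_y l (\<lambda>x y. 0 * H x y) x (2 *\<^sub>R y)"
        using \<open>\<And>y. y \<noteq> 0 \<Longrightarrow> A x y = 0\<close> by (intro partial_y_cong[OF \<open>2 *\<^sub>R y \<noteq> 0\<close>]) simp
      then have "E l (2 *\<^sub>R y) = - partial_x l L x (2 *\<^sub>R y)"
        using A_y[OF \<open>2 *\<^sub>R y \<noteq> 0\<close>] partial_y_cmult[of H x _ l 0, OF diffH[OF \<open>2 *\<^sub>R y \<noteq> 0\<close>]]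
        by simp
      then show ?thesis using eq[OF x \<open>2 *\<^sub>R y \<noteq> 0\<close>, of l] by (simp add: E_def)
    qed
    also have "\<dots> = 2 powr (d - 1) * partial_y l H x y"
      by (rule partial_y_homogeneous[of H, OF diffH[OF y] y homH[OF x]]) simp_all
    also have "\<dots> = 2 powr (d - 1) * partial_x l L x y"
      using 2 3 by simp
    finally have "(2 powr 2 - 2 powr (d - 1)) * partial_x l L x y = 0"
      by (simp only: left_diff_distrib)
    moreover have "2 powr 2 \<noteq> (2 powr (d - 1) :: real)"
      using False by (subst powr_inj) auto
    ultimately have "partial_x l L x y = 0"
      by (simp only: mult_eq_0_iff right_minus_eq) blast
    with 3 show ?thesis by (simp add: E_def)
  qed
qed

section \<open>From spray coefficients to an equation without the inverse tensor\<close>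

lemma invertible_positive_definite:
  fixes A :: "real^'n^'n"
  assumes "\<And>w. w \<noteq> 0 \<Longrightarrow> w \<bullet> (A *v w) > 0"
  shows "invertible A"
proof -
  have "w = 0" if "A *v w = 0" for w
    using assms[of w] that by (cases "w = 0") simp_all
  then show ?thesis
    by (simp add: invertible_left_inverse matrix_left_invertible_ker)
qed

lemma matrix_inv_vector_eq_iff:
  fixes A :: "real^'n^'n"
  assumes "invertible A"
  shows "matrix_inv A *v a = matrix_inv A *v b \<longleftrightarrow> a = b"
proof
  have "A ** matrix_inv A = mat 1"
    using someI_ex[OF assms[unfolded invertible_def]] by (simp add: matrix_inv_def)
  moreover assume "matrix_inv A *v a = matrix_inv A *v b"
  then have "A *v (matrix_inv A *v a) = A *v (matrix_inv A *v b)" by simp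
  ultimately show "a = b" by (simp add: matrix_vector_mul_assoc)
qed simp

text \<open>Both sides apply the same injective matrix, which cancels; the factors
  \<open>1/4\<close> and \<open>- 1/2\<close> combine to \<open>- 2\<close>. The covector
  \<open>h\<close> is arbitrary, so this is pure linear algebra at one point.\<close>

lemma spray_coeff_eq_iff:
  assumes "invertible (fundamental_tensor F x y)"
  shows "(\<forall>i. spray_coeff F i x y =
      - 1/2 * (\<Sum>j\<in>UNIV. matrix_inv (fundamental_tensor F x y) $ i $ j * h j)) \<longleftrightarrow>
    (\<forall>l. (\<Sum>k\<in>UNIV. partial_y l (partial_x k (\<lambda>x y. (F x y)\<^sup>2)) x y * y $ k)
        - partial_x l (\<lambda>x y. (F x y)\<^sup>2) x y = - 2 * h l)"
proof -
  define a where "a = (\<lambda>l. (\<Sum>k\<in>UNIV. partial_y l (partial_x k (\<lambda>x y. (F x y)\<^sup>2)) x y * y $ k)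
        - partial_x l (\<lambda>x y. (F x y)\<^sup>2) x y)"
  let ?B = "matrix_inv (fundamental_tensor F x y)"
  have "(\<forall>i. spray_coeff F i x y = - 1/2 * (\<Sum>j\<in>UNIV. ?B $ i $ j * h j)) \<longleftrightarrow>
    (\<forall>i. (\<Sum>j\<in>UNIV. ?B $ i $ j * a j) = (\<Sum>j\<in>UNIV. ?B $ i $ j * (- 2 * h j)))"
  proof (intro all_cong1)
    fix i
    have "(\<Sum>j\<in>UNIV. ?B $ i $ j * (- 2 * h j)) = - 2 * (\<Sum>j\<in>UNIV. ?B $ i $ j * h j)"
      unfolding sum_distrib_left by (simp add: mult.left_commute)
    then show "spray_coeff F i x y = - 1/2 * (\<Sum>j\<in>UNIV. ?B $ i $ j * h j) \<longleftrightarrow>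
        (\<Sum>j\<in>UNIV. ?B $ i $ j * a j) = (\<Sum>j\<in>UNIV. ?B $ i $ j * (- 2 * h j))"
      unfolding spray_coeff_def a_def[symmetric] a_def[THEN fun_cong, symmetric] by linarith
  qed
  also have "\<dots> \<longleftrightarrow> ?B *v (\<chi> j. a j) = ?B *v (\<chi> j. - 2 * h j)"
    by (simp add: matrix_vector_mult_def vec_eq_iff)
  also have "\<dots> \<longleftrightarrow> (\<forall>l. a l = - 2 * h l)"
    by (subst matrix_inv_vector_eq_iff[OF assms]) (simp add: vec_eq_iff)
  finally show ?thesis by (simp only: a_def)
qed

lemma finsler_metric_square:
  assumes "open \<Omega>" "finsler_metric \<Omega> F"
  shows "Cinf_on (\<Omega> \<times> (UNIV - {0})) (\<lambda>(x, y). (F x y)\<^sup>2)"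
    and "x \<in> \<Omega> \<Longrightarrow> c > 0 \<Longrightarrow> (F x (c *\<^sub>R y))\<^sup>2 = c powr 2 * (F x y)\<^sup>2"
    and "x \<in> \<Omega> \<Longrightarrow> y \<noteq> 0 \<Longrightarrow> invertible (fundamental_tensor F x y)"
proof -
  have "Cinf_on (\<Omega> \<times> (UNIV - {0})) (\<lambda>(x, y). F x y)"
    using assms(2) by (simp add: finsler_metric_def)
  from Cinf_on_mult[OF open_slit[OF assms(1)] this this]
  show "Cinf_on (\<Omega> \<times> (UNIV - {0})) (\<lambda>(x, y). (F x y)\<^sup>2)"
    by (simp add: power2_eq_square case_prod_unfold)
  show "(F x (c *\<^sub>R y))\<^sup>2 = c powr 2 * (F x y)\<^sup>2" if "x \<in> \<Omega>" "c > 0"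
  proof -
    have "F x (c *\<^sub>R y) = c * F x y"
      using assms(2) that unfolding finsler_metric_def by blast
    then show ?thesis using that(2) by (simp add: power_mult_distrib)
  qed
  show "invertible (fundamental_tensor F x y)" if "x \<in> \<Omega>" "y \<noteq> 0"
  proof (rule invertible_positive_definite)
    show "w \<bullet> (fundamental_tensor F x y *v w) > 0" if "w \<noteq> 0" for w
      using assms(2) \<open>x \<in> \<Omega>\<close> \<open>y \<noteq> 0\<close> that unfolding finsler_metric_def by blast
  qed
qed

text \<open>Eliminates the unknown potential and its degree. One direction works on each
  neighbourhood \<open>U\<close> separately; in the other, a single potential on all of
  \<open>\<Omega>\<close> serves every point.\<close>

lemma locally_dually_flat_iff:
  fixes \<Omega> :: "(real^'n::finite) set"
  assumes \<Omega>: "open \<Omega>" and F: "finsler_metric \<Omega> F"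
  defines "L \<equiv> \<lambda>x y. (F x y)\<^sup>2"
  shows "locally_dually_flat \<Omega> F \<longleftrightarrow> (\<forall>x\<in>\<Omega>. \<forall>y. y \<noteq> 0 \<longrightarrow>
    (\<forall>l. (\<Sum>k\<in>UNIV. partial_y l (partial_x k L) x y * y $ k) = 2 * partial_x l L x y))"
    (is "_ \<longleftrightarrow> ?R")
proof
  note L = finsler_metric_square[OF \<Omega> F, folded L_def]
  note spray = spray_coeff_eq_iff[where F = F, folded L_def, OF finsler_metric_square(3)[OF \<Omega> F]]
  {
    assume flat: "locally_dually_flat \<Omega> F"
    show ?R
    proof (intro ballI allI impI)
      fix x y l assume "x \<in> \<Omega>" and y: "y \<noteq> (0 :: real^'n)"
      have "\<exists>U. open U \<and> x \<in> U \<and> U \<subseteq> \<Omega> \<and>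
         (\<exists>(H :: real^'n \<Rightarrow> real^'n \<Rightarrow> real) (d :: real).
            Cinf_on (U \<times> (UNIV - {0})) (\<lambda>(x, y). H x y) \<and>
            (\<forall>x\<in>U. \<forall>y. y \<noteq> 0 \<longrightarrow> (\<forall>c>0. H x (c *\<^sub>R y) = c powr d * H x y)) \<and>
            (\<forall>x\<in>U. \<forall>y. y \<noteq> 0 \<longrightarrow> (\<forall>i. spray_coeff F i x y =
               - 1/2 * (\<Sum>j\<in>UNIV. matrix_inv (fundamental_tensor F x y) $ i $ j *
                          partial_y j H x y))))"
        using flat[unfolded locally_dually_flat_def] \<open>x \<in> \<Omega>\<close> by (rule bspec)
      then obtain U H d where U: "open U" "x \<in> U" "U \<subseteq> \<Omega>"
        and H: "Cinf_on (U \<times> (UNIV - {0})) (\<lambda>(x, y). H x y)"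
        and homH: "\<forall>x\<in>U. \<forall>y. y \<noteq> 0 \<longrightarrow> (\<forall>c>0. H x (c *\<^sub>R y) = c powr d * H x y)"
        and eq: "\<forall>x\<in>U. \<forall>y. y \<noteq> 0 \<longrightarrow> (\<forall>i. spray_coeff F i x y =
             - 1/2 * (\<Sum>j\<in>UNIV. matrix_inv (fundamental_tensor F x y) $ i $ j *
                        partial_y j H x y))"
        by (elim exE conjE)
      have LU: "Cinf_on (U \<times> (UNIV - {0})) (\<lambda>(x, y). L x y)"
        using L(1) by (rule Cinf_on_subset) (use U(3) in auto)
      show "(\<Sum>k\<in>UNIV. partial_y l (partial_x k L) x y * y $ k) = 2 * partial_x l L x y"
      proof (rule dually_flat_potential_imp[OF U(1) LU H _ _ _ U(2) y])
        show "L x (c *\<^sub>R y) = c powr 2 * L x y" if "x \<in> U" "c > 0" for x y c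
          using finsler_metric_square(2)[OF \<Omega> F, of x c y] that U(3) by (auto simp: L_def)
        show "H x (c *\<^sub>R y) = c powr d * H x y" if "x \<in> U" "y \<noteq> 0" "c > 0" for x y c
          using homH that by blast
        show "(\<Sum>k\<in>UNIV. partial_y l (partial_x k L) x y * y $ k) - partial_x l L x y
            = - 2 * partial_y l H x y" if "x \<in> U" "y \<noteq> 0" for x y l
        proof -
          have "x \<in> \<Omega>" using that U(3) by blast
          from eq[rule_format, OF \<open>x \<in> U\<close> \<open>y \<noteq> 0\<close>]
          have "\<forall>i. spray_coeff F i x y =
             - 1/2 * (\<Sum>j\<in>UNIV. matrix_inv (fundamental_tensor F x y) $ i $ j *
                        partial_y j H x y)" ..
          then show ?thesis
            unfolding spray[OF \<open>x \<in> \<Omega>\<close> \<open>y \<noteq> 0\<close>] by (rule spec)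
        qed
      qed
    qed
  }
  {
    assume R: ?R
    \<comment> \<open>Under \<open>?R\<close> the contracted sum has \<open>y\<close>-derivative
      \<open>3 * partial_x l L\<close>. The constant \<open>- 1/6\<close> thus gives
      \<open>partial_y l H = - 1/2 * partial_x l L\<close>, as the potential equation
      demands.\<close>
    define H where "H = (\<lambda>x y. (- 1/6) * (\<Sum>k\<in>UNIV. partial_x k L x y * y $ k))"
    have M: "Cinf_on (\<Omega> \<times> (UNIV - {0})) (\<lambda>(x, y). partial_x k L x y)" for k
      by (rule Cinf_on_partial_x[OF \<Omega> L(1)])
    have "bounded_linear (\<lambda>z :: (real^'n) \<times> (real^'n). snd z $ k)" for k
      by (rule bounded_linear_compose[OF bounded_linear_vec_nth bounded_linear_snd])
    note comp = Cinf_on_linear[OF this]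
    have "Cinf_on (\<Omega> \<times> (UNIV - {0}))
        (\<lambda>z. (- 1/6) * (\<Sum>k\<in>UNIV. (\<lambda>(x, y). partial_x k L x y) z * snd z $ k))"
      by (intro Cinf_on_mult Cinf_on_sum open_slit \<Omega> M comp Cinf_on_const)
    then have "Cinf_on (\<Omega> \<times> (UNIV - {0})) (\<lambda>(x, y). H x y)"
      by (simp add: H_def case_prod_unfold)
    moreover have "H x (c *\<^sub>R y) = c powr 3 * H x y" if "x \<in> \<Omega>" "y \<noteq> 0" "c > 0" for x y c
    proof -
      have "(\<lambda>(x, y). L x y) differentiable (at (x, y))"
        using that by (intro Cinf_onD(1)[OF L(1)]) simp
      then have "partial_x k L x (c *\<^sub>R y) = c powr 2 * partial_x k L x y" for k
        by (rule partial_x_homogeneous[OF \<Omega> that(1)])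
          (use finsler_metric_square(2)[OF \<Omega> F, of _ c y] that(3) in \<open>simp add: L_def\<close>)
      moreover have "c powr 3 = c powr 2 * c"
        using that(3) powr_add[of c 2 1] by simp
      ultimately show ?thesis
        by (simp only: H_def sum_distrib_left vector_scaleR_component real_scaleR_def) (simp only: mult_ac)
    qed
    moreover have spray_H: "\<forall>i. spray_coeff F i x y =
        - 1/2 * (\<Sum>j\<in>UNIV. matrix_inv (fundamental_tensor F x y) $ i $ j * partial_y j H x y)"
      if "x \<in> \<Omega>" "y \<noteq> 0" for x y
    proof -
      have diffM: "partial_x k L x differentiable (at y)" for k
        by (rule differentiable_fibre(1), rule Cinf_onD(1)[OF M]) (simp add: that)
      have diffC: "(\<lambda>y. \<Sum>k\<in>UNIV. partial_x k L x y * y $ k) differentiable (at y)"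
      proof (rule differentiable_sum)
        have "(\<lambda>y :: real^'n. y $ k) differentiable (at y)" for k
          by (rule bounded_linear_imp_differentiable, rule bounded_linear_vec_nth)
        then show "\<forall>k\<in>UNIV. (\<lambda>y. partial_x k L x y * y $ k) differentiable (at y)"
          by (intro ballI differentiable_mult diffM)
      qed simp
      have "partial_y l H x y = - 1/6 *
          ((\<Sum>k\<in>UNIV. partial_y l (partial_x k L) x y * y $ k) + partial_x l L x y)" for l
        unfolding H_def partial_y_contraction[of "\<lambda>k. partial_x k L", OF diffM, symmetric]
        by (rule partial_y_cmult[of "\<lambda>x y. \<Sum>k\<in>UNIV. partial_x k L x y * y $ k", OF diffC])
      moreover have "(\<Sum>k\<in>UNIV. partial_y l (partial_x k L) x y * y $ k) = 2 * partial_x l L x y"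
        for l
        using R that by blast
      ultimately show ?thesis
        unfolding spray[OF that] by simp
    qed
    moreover have "\<forall>x\<in>\<Omega>. \<forall>y. y \<noteq> 0 \<longrightarrow> (\<forall>i. spray_coeff F i x y = - 1/2 *
        (\<Sum>j\<in>UNIV. matrix_inv (fundamental_tensor F x y) $ i $ j * partial_y j H x y))"
      by (rule ballI, rule allI, rule impI) (rule spray_H)
    ultimately show "locally_dually_flat \<Omega> F"
      unfolding locally_dually_flat_def using \<Omega>
      by (intro ballI exI[of _ \<Omega>] exI[of _ H] exI[of _ "3::real"] conjI) simp_all
  }
qed

subsection \<open>Spherically symmetric metrics\<close>

text \<open>Homogeneity reduces to the unit vector \<open>w\<close> in the direction of
  \<open>y\<close>, where the second argument of \<open>\<phi>\<close> is 1.\<close>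

lemma finsler_profile:
  assumes F: "finsler_metric \<Omega> F" "spherically_symmetric \<Omega> \<phi> F" and "x \<in> \<Omega>" "y \<noteq> 0"
  shows "F x y = norm y * \<phi> (norm x) 1 (x \<bullet> y / norm y)"
proof -
  define w where "w = y /\<^sub>R norm y"
  have w: "w \<noteq> 0" "norm w = 1" "y = norm y *\<^sub>R w" "x \<bullet> w = x \<bullet> y / norm y"
    using \<open>y \<noteq> 0\<close> by (simp_all add: w_def divide_inverse mult.commute)
  have "F x (norm y *\<^sub>R w) = norm y * F x w"
    using F(1) assms(3,4) unfolding finsler_metric_def by simp
  moreover have "F x w = \<phi> (norm x) (norm w) (x \<bullet> w)"
    using F(2) assms(3) w(1) unfolding spherically_symmetric_def by blast
  ultimately show ?thesis using w by metis
qed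

section \<open>Differentiability of the profile of a spherically symmetric metric\<close>

lemma sqrt_diff_squares_has_derivative:
  fixes r s :: real
  assumes "\<bar>s\<bar> < r"
  shows "((\<lambda>z. sqrt ((fst z)\<^sup>2 - (snd z)\<^sup>2)) has_derivative
      (\<lambda>h. (r * fst h - s * snd h) / sqrt (r\<^sup>2 - s\<^sup>2))) (at (r, s))"
proof -
  have pos: "r\<^sup>2 - s\<^sup>2 > 0"
    using assms power_strict_mono[of "\<bar>s\<bar>" r 2] by simp
  have "((\<lambda>z. (fst z)\<^sup>2 - (snd z)\<^sup>2) has_derivative (\<lambda>h. 2 * (r * fst h - s * snd h))) (at (r, s))"
    by (auto intro!: derivative_eq_intros simp: algebra_simps)
  then show ?thesis
    by (rule has_derivative_real_sqrt[rotated, THEN has_derivative_eq_rhs])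
      (use pos in \<open>auto simp: fun_eq_iff field_simps\<close>)
qed

text \<open>For orthonormal \<open>e1\<close>, \<open>e2\<close> the map sends \<open>(r, s)\<close>
  to a pair \<open>(x, y)\<close> with \<open>norm x = norm y = r\<close> and
  \<open>x \<bullet> y / norm y = s\<close>. It is a section of the passage from
  \<open>(x, y)\<close> to the variables \<open>(r, s)\<close>.\<close>

lemma frame_curve_has_derivative:
  fixes e1 e2 :: "'a::real_normed_vector"
  assumes "\<bar>s\<bar> < r"
  shows "((\<lambda>z. (fst z *\<^sub>R e1, snd z *\<^sub>R e1 + sqrt ((fst z)\<^sup>2 - (snd z)\<^sup>2) *\<^sub>R e2)) has_derivative
    (\<lambda>h. (fst h *\<^sub>R e1, snd h *\<^sub>R e1 + ((r * fst h - s * snd h) / sqrt (r\<^sup>2 - s\<^sup>2)) *\<^sub>R e2)))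
    (at (r, s))"
proof -
  have "((\<lambda>z. sqrt ((fst z)\<^sup>2 - (snd z)\<^sup>2) *\<^sub>R e2) has_derivative
      (\<lambda>h. ((r * fst h - s * snd h) / sqrt (r\<^sup>2 - s\<^sup>2)) *\<^sub>R e2)) (at (r, s))"
    by (rule has_derivative_scaleR_left[OF sqrt_diff_squares_has_derivative[OF assms]])
  moreover have "((\<lambda>z. fst z *\<^sub>R e1) has_derivative (\<lambda>h. fst h *\<^sub>R e1)) (at (r, s))"
    by (intro has_derivative_scaleR_left has_derivative_fst has_derivative_ident)
  moreover have "((\<lambda>z. snd z *\<^sub>R e1) has_derivative (\<lambda>h. snd h *\<^sub>R e1)) (at (r, s))"
    by (intro has_derivative_scaleR_left has_derivative_snd has_derivative_ident)
  ultimately show ?thesis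
    by (intro has_derivative_Pair has_derivative_add)
qed

text \<open>The dimension hypothesis enters through this lemma: it provides a direction orthogonal
  to a given vector.\<close>

lemma orthonormal_frame_dim2:
  fixes x :: "real^'n::finite"
  assumes "CARD('n) \<ge> 2" "x \<noteq> 0"
  obtains e where "norm e = 1" "x \<bullet> e = 0"
proof -
  have "DIM(real^'n) \<ge> 2" using assms(1) by simp
  then obtain w where "w \<noteq> 0" "orthogonal x w"
    using orthogonal_to_vector_exists[of x] by blast
  then show ?thesis
    by (intro that[of "w /\<^sub>R norm w"]) (simp_all add: orthogonal_def)
qed

lemma norm_frame_vector:
  fixes e1 e2 :: "'a::real_inner"
  assumes "norm e1 = 1" "norm e2 = 1" "e1 \<bullet> e2 = 0" "\<bar>s\<bar> \<le> r"
  shows "norm (s *\<^sub>R e1 + sqrt (r\<^sup>2 - s\<^sup>2) *\<^sub>R e2) = r"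
proof -
  have "s\<^sup>2 \<le> r\<^sup>2" using assms(4) by (simp add: abs_le_square_iff[symmetric])
  moreover have "e1 \<bullet> e1 = 1" "e2 \<bullet> e2 = 1" "e2 \<bullet> e1 = 0"
    using assms(1-3) by (simp_all add: dot_square_norm inner_commute)
  ultimately have "(norm (s *\<^sub>R e1 + sqrt (r\<^sup>2 - s\<^sup>2) *\<^sub>R e2))\<^sup>2 = r\<^sup>2"
    using assms(3) by (simp add: power2_norm_eq_inner inner_add_left inner_add_right
        flip: power2_eq_square)
  then show ?thesis using assms(4) by (simp add: power2_eq_iff_nonneg)
qed

lemma partials_eq_of_has_derivative:
  assumes "((\<lambda>z. f (fst z) (snd z)) has_derivative (\<lambda>h. a * fst h + b * snd h)) (at (r, s))"
  shows "partial_r f r s = a" "partial_s f r s = b"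
proof -
  have "((\<lambda>t. (t, s)) has_derivative (\<lambda>t. (t, 0))) (at r)"
    by (auto intro!: derivative_eq_intros)
  from has_derivative_compose[OF this assms]
  show "partial_r f r s = a"
    unfolding partial_r_def by (intro DERIV_imp_deriv) (simp add: has_field_derivative_def)
  have "((\<lambda>t. (r, t)) has_derivative (\<lambda>t. (0, t))) (at s)"
    by (auto intro!: derivative_eq_intros)
  from has_derivative_compose[OF this assms]
  show "partial_s f r s = b"
    unfolding partial_s_def by (intro DERIV_imp_deriv) (simp add: has_field_derivative_def)
qed

text \<open>No regularity of \<open>\<phi>\<close> is assumed; it is inherited from \<open>F\<close>
  by pulling back along the section \<open>P\<close>. The first derivatives of the profile come out
  as expressions in derivatives of \<open>F\<close> along \<open>P\<close>, hence are differentiable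
  again.\<close>

lemma profile_C2:
  fixes \<Omega> :: "(real^'n::finite) set"
  assumes n: "CARD('n) \<ge> 2" and \<Omega>: "open \<Omega>"
    and F: "finsler_metric \<Omega> F" "spherically_symmetric \<Omega> \<phi> F"
    and x: "x \<in> \<Omega>" and s: "\<bar>s\<bar> < norm x"
  defines "\<psi> \<equiv> \<lambda>r s. \<phi> r 1 s"
  shows "((\<lambda>z. \<psi> (fst z) (snd z)) has_derivative
      (\<lambda>h. partial_r \<psi> (norm x) s * fst h + partial_s \<psi> (norm x) s * snd h)) (at (norm x, s))"
    and "((\<lambda>s. partial_r \<psi> (norm x) s) has_real_derivative
      partial_s (partial_r \<psi>) (norm x) s) (at s)"
    and "((\<lambda>s. partial_s \<psi> (norm x) s) has_real_derivative
      partial_s (partial_s \<psi>) (norm x) s) (at s)"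
proof -
  have "x \<noteq> 0" using s by auto
  from orthonormal_frame_dim2[OF n this]
  obtain e2 where e2: "norm e2 = 1" "x \<bullet> e2 = 0" .
  define e1 where "e1 = x /\<^sub>R norm x"
  have e: "norm e1 = 1" "norm e2 = 1" "e1 \<bullet> e2 = 0" "norm x *\<^sub>R e1 = x" "e1 \<bullet> e1 = 1"
    using \<open>x \<noteq> 0\<close> e2 by (simp_all add: e1_def dot_square_norm power2_eq_square)
  define P where "P = (\<lambda>z. (fst z *\<^sub>R e1, snd z *\<^sub>R e1 + sqrt ((fst z)\<^sup>2 - (snd z)\<^sup>2) *\<^sub>R e2))"
  \<comment> \<open>An open set of parameters on which the square root is differentiable and
    \<open>P\<close> stays in the slit bundle.\<close>
  define V where "V = {z. fst z *\<^sub>R e1 \<in> \<Omega> \<and> \<bar>snd z\<bar> < fst z}"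
  have "open V"
  proof -
    have "open ((\<lambda>z::real\<times>real. fst z *\<^sub>R e1) -` \<Omega>)"
      by (intro open_vimage \<Omega> continuous_intros)
    moreover have "open {z::real\<times>real. \<bar>snd z\<bar> < fst z}"
      by (intro open_Collect_less continuous_intros)
    ultimately have "open ((\<lambda>z. fst z *\<^sub>R e1) -` \<Omega> \<inter> {z. \<bar>snd z\<bar> < fst z})"
      by (rule open_Int)
    then show ?thesis by (simp add: V_def vimage_def Collect_conj_eq)
  qed
  have V_x: "(norm x, s) \<in> V" if "\<bar>s\<bar> < norm x" for s
    using that x e(4) by (simp add: V_def)
  have normP: "norm (snd (P z)) = fst z" if "z \<in> V" for z
    using norm_frame_vector[OF e(1-3), of "snd z" "fst z"] that by (simp add: P_def V_def)
  have P_slit: "P z \<in> \<Omega> \<times> (UNIV - {0})" if "z \<in> V" for z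
    using normP[OF that] that by (auto simp: P_def V_def)
  define Fu where "Fu = (\<lambda>(x, y). F x y)"
  have Cinf: "Cinf_on (\<Omega> \<times> (UNIV - {0})) Fu"
    using F(1) by (simp add: finsler_metric_def Fu_def)
  define D where "D w z = frechet_derivative Fu (at z) w" for w z
  have CinfD: "Cinf_on (\<Omega> \<times> (UNIV - {0})) (D w)" for w
    unfolding D_def by (rule Cinf_onD(3)[OF Cinf])
  have P_deriv: "(P has_derivative (\<lambda>h. (fst h *\<^sub>R e1, snd h *\<^sub>R e1 +
      ((fst z * fst h - snd z * snd h) / sqrt ((fst z)\<^sup>2 - (snd z)\<^sup>2)) *\<^sub>R e2))) (at z)"
    if "z \<in> V" for z
    using frame_curve_has_derivative[of "snd z" "fst z" e1 e2] that
    unfolding P_def V_def by simp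
  have diffK: "(\<lambda>z. K (P z)) differentiable (at z)"
    if "Cinf_on (\<Omega> \<times> (UNIV - {0})) K" "z \<in> V" for K :: "_ \<Rightarrow> real" and z
  proof -
    have "K differentiable (at (P z))"
      by (rule Cinf_onD(1)[OF that(1) P_slit[OF that(2)]])
    moreover have "P differentiable (at z)"
      using P_deriv[OF that(2)] by (rule differentiableI)
    ultimately show ?thesis by (rule differentiable_compose)
  qed
  have \<psi>_eq: "\<psi> (fst z) (snd z) = Fu (P z) / fst z" if "z \<in> V" for z
  proof -
    have pos: "fst z > 0" using that by (auto simp: V_def)
    have "fst (P z) \<in> \<Omega>" "snd (P z) \<noteq> 0"
      using P_slit[OF that] by (auto simp: mem_Times_iff)
    moreover have "norm (fst (P z)) = fst z" using pos e(1) by (simp add: P_def)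
    moreover have "fst (P z) \<bullet> snd (P z) / fst z = snd z"
      using pos e(3,5) by (simp add: P_def inner_add_right)
    ultimately have "Fu (P z) = fst z * \<phi> (fst z) 1 (snd z)"
      using finsler_profile[OF F, of "fst (P z)" "snd (P z)"] normP[OF that]
      by (simp add: Fu_def case_prod_unfold)
    then show ?thesis using pos by (simp add: \<psi>_def)
  qed
  define q where "q z = sqrt ((fst z)\<^sup>2 - (snd z)\<^sup>2)" for z :: "real \<times> real"
  have q: "q z > 0" "q differentiable (at z)" if "z \<in> V" for z
  proof -
    have "\<bar>snd z\<bar> < fst z" using that by (simp add: V_def)
    then show "q z > 0"
      using power_strict_mono[of "\<bar>snd z\<bar>" "fst z" 2] by (simp add: q_def)
    have "((\<lambda>z. sqrt ((fst z)\<^sup>2 - (snd z)\<^sup>2)) has_derivative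
      (\<lambda>h. (fst z * fst h - snd z * snd h) / sqrt ((fst z)\<^sup>2 - (snd z)\<^sup>2))) (at z)"
      using sqrt_diff_squares_has_derivative[OF \<open>\<bar>snd z\<bar> < fst z\<close>] by simp
    then show "q differentiable (at z)"
      unfolding q_def by (rule differentiableI)
  qed
  \<comment> \<open>\<open>a\<close> and \<open>b\<close> are the coefficients of
    \<open>fst h\<close> and \<open>snd h\<close> in the derivative of
    \<open>Fu (P z) / fst z\<close>; the factors over \<open>q z\<close> come from the square root
    in \<open>P\<close>.\<close>
  define a where "a z = (D (e1, 0) (P z) + fst z / q z * D (0, e2) (P z) - Fu (P z) / fst z) / fst z" for z
  define b where "b z = (D (0, e1) (P z) - snd z / q z * D (0, e2) (P z)) / fst z" for z
  have \<psi>_deriv: "((\<lambda>z. \<psi> (fst z) (snd z)) has_derivative (\<lambda>h. a z * fst h + b z * snd h)) (at z)"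
    if z: "z \<in> V" for z
  proof -
    have pos: "fst z > 0" using z by (auto simp: V_def)
    define c where "c h = (fst z * fst h - snd z * snd h) / q z" for h :: "real \<times> real"
    have "Fu differentiable (at (P z))"
      by (rule Cinf_onD(1)[OF Cinf P_slit[OF z]])
    then have DF: "(Fu has_derivative (\<lambda>w. D w (P z))) (at (P z))"
      unfolding D_def by (simp flip: frechet_derivative_works)
    have lin: "D (fst h *\<^sub>R e1, snd h *\<^sub>R e1 + c h *\<^sub>R e2) (P z)
        = fst h * D (e1, 0) (P z) + snd h * D (0, e1) (P z) + c h * D (0, e2) (P z)" for h
    proof -
      note L = has_derivative_linear[OF DF]
      have "(fst h *\<^sub>R e1, snd h *\<^sub>R e1 + c h *\<^sub>R e2)
          = fst h *\<^sub>R (e1, 0) + snd h *\<^sub>R (0, e1) + c h *\<^sub>R (0, e2)"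
        by simp
      then show ?thesis
        by (simp only: linear_add[OF L] linear_cmul[OF L] real_scaleR_def)
    qed
    have "((\<lambda>z. Fu (P z)) has_derivative
        (\<lambda>h. fst h * D (e1, 0) (P z) + snd h * D (0, e1) (P z) + c h * D (0, e2) (P z))) (at z)"
      using has_derivative_compose[OF P_deriv[OF z] DF]
      by (simp only: lin[unfolded c_def q_def] c_def q_def)
    moreover have "(fst has_derivative fst) (at z)"
      by (rule has_derivative_fst[OF has_derivative_ident])
    ultimately have "((\<lambda>z. Fu (P z) / fst z) has_derivative
        (\<lambda>h. - Fu (P z) * (inverse (fst z) * fst h * inverse (fst z)) +
          (fst h * D (e1, 0) (P z) + snd h * D (0, e1) (P z) + c h * D (0, e2) (P z)) / fst z)) (at z)"
      by (rule has_derivative_divide) (use pos in simp)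
    moreover have "- Fu (P z) * (inverse (fst z) * fst h * inverse (fst z)) +
          (fst h * D (e1, 0) (P z) + snd h * D (0, e1) (P z) + c h * D (0, e2) (P z)) / fst z
          = a z * fst h + b z * snd h" for h
      using pos q(1)[OF z] by (simp add: a_def b_def c_def field_simps)
    ultimately have "((\<lambda>z. Fu (P z) / fst z) has_derivative (\<lambda>h. a z * fst h + b z * snd h)) (at z)"
      by simp
    then show ?thesis
      by (rule has_derivative_transform_within_open[OF _ \<open>open V\<close> z]) (simp add: \<psi>_eq)
  qed
  note partials = partials_eq_of_has_derivative[OF \<psi>_deriv[OF V_x]]
  show "((\<lambda>z. \<psi> (fst z) (snd z)) has_derivative
      (\<lambda>h. partial_r \<psi> (norm x) s * fst h + partial_s \<psi> (norm x) s * snd h)) (at (norm x, s))"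
    using \<psi>_deriv[OF V_x[OF s]] partials[OF s] by simp
  have "fst differentiable (at z)" "snd differentiable (at z)" for z :: "real \<times> real"
    by (rule bounded_linear_imp_differentiable, rule bounded_linear_fst)
      (rule bounded_linear_imp_differentiable, rule bounded_linear_snd)
  note diff_intros = differentiable_divide differentiable_mult differentiable_diff differentiable_add
     diffK[OF Cinf] diffK[OF CinfD] q(2) this
  have nz: "fst z \<noteq> 0" "q z \<noteq> 0" if "z \<in> V" for z
    using q(1)[OF that] that by (auto simp: V_def)
  have ab: "a differentiable (at z)" "b differentiable (at z)" if "z \<in> V" for z
    unfolding a_def b_def by (intro diff_intros that nz)+
  \<comment> \<open>The partial derivatives of the profile are known to equal \<open>a\<close> and
    \<open>b\<close> only for \<open>\<bar>s\<bar> < norm x\<close>; on this open interval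
    differentiability carries over.\<close>
  have derivs: "((\<lambda>s. f (norm x) s) has_real_derivative partial_s f (norm x) s) (at s)"
    if g: "g differentiable (at (norm x, s))" and fg: "\<And>s. \<bar>s\<bar> < norm x \<Longrightarrow> f (norm x) s = g (norm x, s)"
    for f g
  proof -
    have "(\<lambda>s. (norm x, s)) differentiable (at s)"
      by (rule differentiableI[where f' = "\<lambda>t. (0, t)"]) (auto intro!: derivative_eq_intros)
    from differentiable_compose[OF g this]
    have "((\<lambda>s. g (norm x, s)) has_real_derivative deriv (\<lambda>s. g (norm x, s)) s) (at s)"
      by (simp add: DERIV_deriv_iff_real_differentiable)
    then have "((\<lambda>s. f (norm x) s) has_real_derivative deriv (\<lambda>s. g (norm x, s)) s) (at s)"
      by (rule has_field_derivative_transform_within_open[where S = "{- norm x<..<norm x}"])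
        (use s fg in auto)
    then show ?thesis
      unfolding partial_s_def by (simp add: DERIV_imp_deriv)
  qed
  show "((\<lambda>s. partial_r \<psi> (norm x) s) has_real_derivative
      partial_s (partial_r \<psi>) (norm x) s) (at s)"
    and "((\<lambda>s. partial_s \<psi> (norm x) s) has_real_derivative
      partial_s (partial_s \<psi>) (norm x) s) (at s)"
    by (rule derivs[OF ab(1)[OF V_x[OF s]]], rule partials(1), assumption)
      (rule derivs[OF ab(2)[OF V_x[OF s]]], rule partials(2), assumption)
qed

section \<open>The squared metric and its derivatives in the variables \<open>(r, s)\<close>\<close>

lemma norm_line_has_derivative:
  fixes x :: "real^'n::finite"
  assumes "x \<noteq> 0"
  shows "((\<lambda>t. norm (x + t *\<^sub>R axis k 1)) has_real_derivative x $ k / norm x) (at 0)"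
proof -
  have "((\<lambda>t. (x + t *\<^sub>R axis k 1) \<bullet> (x + t *\<^sub>R axis k 1)) has_real_derivative 2 * x $ k) (at 0)"
  proof -
    have "(x + t *\<^sub>R axis k 1) \<bullet> (x + t *\<^sub>R axis k 1) = x \<bullet> x + (2 * x $ k) * t + t * t" for t
      by (simp add: inner_add_left inner_add_right inner_axis inner_axis' distrib_left)
    moreover have "((\<lambda>t. x \<bullet> x + (2 * x $ k) * t + t * t) has_real_derivative 2 * x $ k) (at 0)"
      by (auto intro!: derivative_eq_intros)
    ultimately show ?thesis by (simp only:)
  qed
  moreover have "(sqrt has_real_derivative inverse (sqrt (x \<bullet> x)) / 2)
      (at ((x + 0 *\<^sub>R axis k 1) \<bullet> (x + 0 *\<^sub>R axis k 1)))"
    using DERIV_real_sqrt[of "x \<bullet> x"] assms by simp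
  ultimately have "((\<lambda>t. sqrt ((x + t *\<^sub>R axis k 1) \<bullet> (x + t *\<^sub>R axis k 1))) has_real_derivative
      inverse (sqrt (x \<bullet> x)) / 2 * (2 * x $ k)) (at 0)"
    by (intro DERIV_chain2[where f = sqrt
        and g = "\<lambda>t. (x + t *\<^sub>R axis k 1) \<bullet> (x + t *\<^sub>R axis k 1)"])
  moreover have "inverse (sqrt (x \<bullet> x)) / 2 * (2 * x $ k) = x $ k / norm x"
    using assms by (simp add: norm_eq_sqrt_inner[symmetric] field_simps)
  ultimately show ?thesis
    by (simp only: norm_eq_sqrt_inner[symmetric])
qed

text \<open>Strict Cauchy-Schwarz expresses linear independence of \<open>x\<close> and
  \<open>y\<close>; it places \<open>(r, s)\<close> in the region where \<open>profile_C2\<close>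
  applies.\<close>

lemma strict_cauchy_schwarz_bounds:
  fixes x y :: "'a::real_inner"
  assumes "\<bar>x \<bullet> y\<bar> < norm x * norm y"
  shows "x \<noteq> 0" "y \<noteq> 0" "\<bar>x \<bullet> y / norm y\<bar> < norm x"
proof -
  show "x \<noteq> 0" and y: "y \<noteq> 0" using assms by auto
  have "\<bar>x \<bullet> y\<bar> / norm y < norm x"
    by (rule mult_imp_div_pos_less) (use y assms in simp_all)
  then show "\<bar>x \<bullet> y / norm y\<bar> < norm x" by simp
qed

text \<open>Near \<open>x\<close> the squared metric is
  \<open>(norm y)\<^sup>2 * (\<psi> r s)\<^sup>2\<close>. Only \<open>r\<close> and \<open>s\<close>
  move with \<open>x\<close>, at rates \<open>x $ k / norm x\<close> and
  \<open>y $ k / norm y\<close>.\<close>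

lemma partial_x_square_spherical:
  fixes \<Omega> :: "(real^'n::finite) set"
  assumes n: "CARD('n) \<ge> 2" and \<Omega>: "open \<Omega>"
    and F: "finsler_metric \<Omega> F" "spherically_symmetric \<Omega> \<phi> F"
    and x: "x \<in> \<Omega>" and xy: "\<bar>x \<bullet> y\<bar> < norm x * norm y"
  defines "\<psi> \<equiv> \<lambda>r s. \<phi> r 1 s" and "s \<equiv> x \<bullet> y / norm y"
  shows "partial_x k (\<lambda>x y. (F x y)\<^sup>2) x y = 2 * (norm y)\<^sup>2 * \<psi> (norm x) s *
    (partial_r \<psi> (norm x) s * (x $ k / norm x) + partial_s \<psi> (norm x) s * (y $ k / norm y))"
proof -
  note nz = strict_cauchy_schwarz_bounds[OF xy]
  define g where "g t = (norm (x + t *\<^sub>R axis k 1), (x + t *\<^sub>R axis k 1) \<bullet> y / norm y)" for t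
  have "((\<lambda>t. (x + t *\<^sub>R axis k 1) \<bullet> y / norm y) has_real_derivative y $ k / norm y) (at 0)"
    using nz(2) by (auto intro!: derivative_eq_intros simp: inner_add_left inner_axis')
  then have g: "(g has_derivative (\<lambda>t. (x $ k / norm x * t, y $ k / norm y * t))) (at 0)"
    using norm_line_has_derivative[OF nz(1), of k]
    unfolding g_def has_field_derivative_def by (intro has_derivative_Pair)
  have "((\<lambda>z. \<psi> (fst z) (snd z)) has_derivative
      (\<lambda>h. partial_r \<psi> (norm x) s * fst h + partial_s \<psi> (norm x) s * snd h)) (at (g 0))"
    using profile_C2(1)[OF n \<Omega> F x nz(3)] by (simp add: g_def \<psi>_def s_def)
  from has_derivative_compose[OF g this]
  have "((\<lambda>t. \<psi> (fst (g t)) (snd (g t))) has_real_derivative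
      (partial_r \<psi> (norm x) s * (x $ k / norm x) + partial_s \<psi> (norm x) s * (y $ k / norm y))) (at 0)"
    by (rule has_derivative_imp_has_field_derivative) (simp add: algebra_simps)
  from DERIV_cmult[OF DERIV_power[OF this, of 2], of "(norm y)\<^sup>2"]
  have deriv: "((\<lambda>t. (norm y)\<^sup>2 * (\<psi> (fst (g t)) (snd (g t)))\<^sup>2) has_real_derivative
    2 * (norm y)\<^sup>2 * \<psi> (norm x) s *
    (partial_r \<psi> (norm x) s * (x $ k / norm x) + partial_s \<psi> (norm x) s * (y $ k / norm y))) (at 0)"
  proof (rule DERIV_cong)
    have "g 0 = (norm x, s)" by (simp add: g_def s_def)
    then show "(norm y)\<^sup>2 * (real 2 * ((partial_r \<psi> (norm x) s * (x $ k / norm x)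
        + partial_s \<psi> (norm x) s * (y $ k / norm y)) * \<psi> (fst (g 0)) (snd (g 0)) ^ (2 - Suc 0)))
      = 2 * (norm y)\<^sup>2 * \<psi> (norm x) s *
        (partial_r \<psi> (norm x) s * (x $ k / norm x) + partial_s \<psi> (norm x) s * (y $ k / norm y))"
      by simp
  qed
  have "\<forall>\<^sub>F t in nhds 0. (norm y)\<^sup>2 * (\<psi> (fst (g t)) (snd (g t)))\<^sup>2
      = (F (x + t *\<^sub>R axis k 1) y)\<^sup>2"
    using eventually_translate_in_open[OF \<Omega> x, of "axis k 1"]
  proof eventually_elim
    case (elim t)
    show ?case
      using finsler_profile[OF F elim nz(2)] by (simp add: g_def \<psi>_def power_mult_distrib)
  qed
  from deriv_cong_ev[OF this refl] show ?thesis
    unfolding partial_x_def DERIV_imp_deriv[OF deriv] by (rule sym)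
qed

text \<open>By \<open>partial_y_contraction\<close> the defect is the \<open>y\<close>-derivative of
  the contracted sum \<open>A\<close> minus \<open>3 * partial_x l L\<close>. As \<open>A\<close> is
  a closed expression in \<open>norm y\<close> and \<open>\<sigma> y\<close>, mixed second
  derivatives of \<open>L\<close> need not be computed one by one.\<close>

lemma flatness_defect_spherical:
  fixes \<Omega> :: "(real^'n::finite) set"
  assumes n: "CARD('n) \<ge> 2" and \<Omega>: "open \<Omega>"
    and F: "finsler_metric \<Omega> F" "spherically_symmetric \<Omega> \<phi> F"
    and x: "x \<in> \<Omega>" and xy: "\<bar>x \<bullet> y\<bar> < norm x * norm y"
  defines "\<psi> \<equiv> \<lambda>r s. \<phi> r 1 s" and "s \<equiv> x \<bullet> y / norm y" and "L \<equiv> \<lambda>x y. (F x y)\<^sup>2"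
  shows "(\<Sum>k\<in>UNIV. partial_y l (partial_x k L) x y * y $ k) - 2 * partial_x l L x y
    = 2 * (norm y)\<^sup>2 / norm x * (x $ l - s * y $ l / norm y) *
      (s * (partial_r \<psi> (norm x) s * partial_s \<psi> (norm x) s
          + \<psi> (norm x) s * partial_s (partial_r \<psi>) (norm x) s)
       + norm x * ((partial_s \<psi> (norm x) s)\<^sup>2
          + \<psi> (norm x) s * partial_s (partial_s \<psi>) (norm x) s)
       - 2 * \<psi> (norm x) s * partial_r \<psi> (norm x) s)"
proof -
  note nz = strict_cauchy_schwarz_bounds[OF xy]
  define r where "r = norm x"
  define \<sigma> where "\<sigma> y = x \<bullet> y / norm y" for y
  define A where "A y = 2 * norm y ^ 3 * (\<psi> r (\<sigma> y) *
    (\<sigma> y * partial_r \<psi> r (\<sigma> y) / r + partial_s \<psi> r (\<sigma> y)))" for y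
  have L_x: "partial_x k L x y = 2 * (norm y)\<^sup>2 * \<psi> r (\<sigma> y) *
    (partial_r \<psi> r (\<sigma> y) * (x $ k / r) + partial_s \<psi> r (\<sigma> y) * (y $ k / norm y))"
    if "\<bar>x \<bullet> y\<bar> < norm x * norm y" for k y
    unfolding L_def \<psi>_def \<sigma>_def r_def by (rule partial_x_square_spherical[OF n \<Omega> F x that])
  have A: "(\<Sum>k\<in>UNIV. partial_x k L x y * y $ k) = A y"
    if "\<bar>x \<bullet> y\<bar> < norm x * norm y" for y
  proof -
    have y: "norm y \<noteq> 0" using that by auto
    have "(\<Sum>k\<in>UNIV. partial_x k L x y * y $ k) = 2 * (norm y)\<^sup>2 * \<psi> r (\<sigma> y) *
        (partial_r \<psi> r (\<sigma> y) / r * (\<Sum>k\<in>UNIV. x $ k * y $ k)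
          + partial_s \<psi> r (\<sigma> y) / norm y * (\<Sum>k\<in>UNIV. y $ k * y $ k))"
      unfolding L_x[OF that] sum_distrib_left sum.distrib[symmetric]
      by (intro sum.cong refl) (simp add: algebra_simps)
    also have "(\<Sum>k\<in>UNIV. x $ k * y $ k) = norm y * \<sigma> y"
      using y by (simp add: \<sigma>_def inner_vec_def)
    also have "(\<Sum>k\<in>UNIV. y $ k * y $ k) = norm y * norm y"
      using dot_square_norm[of y] by (simp add: inner_vec_def power2_eq_square)
    finally show ?thesis
      using y by (simp add: A_def power2_eq_square power3_eq_cube algebra_simps)
  qed
  have "partial_y l (\<lambda>x y. \<Sum>k\<in>UNIV. partial_x k L x y * y $ k) x y
      = (\<Sum>k\<in>UNIV. partial_y l (partial_x k L) x y * y $ k) + partial_x l L x y"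
  proof (rule partial_y_contraction[where M = "\<lambda>k. partial_x k L"])
    fix k
    have "Cinf_on (\<Omega> \<times> (UNIV - {0})) (\<lambda>(x, y). partial_x k L x y)"
      unfolding L_def by (rule Cinf_on_partial_x[OF \<Omega> finsler_metric_square(1)[OF \<Omega> F(1)]])
    then show "partial_x k L x differentiable (at y)"
      by (rule differentiable_fibre(1)[OF Cinf_onD(1)]) (use x nz in simp)
  qed
  moreover have "partial_y l (\<lambda>x y. \<Sum>k\<in>UNIV. partial_x k L x y * y $ k) x y
      = deriv (\<lambda>t. A (y + t *\<^sub>R axis l 1)) 0"
    unfolding partial_y_def
  proof (rule deriv_cong_ev)
    \<comment> \<open>Independence from \<open>x\<close> is an open condition on \<open>y\<close>,
      so the closed form of \<open>A\<close> persists for small \<open>t\<close> and may be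
      differentiated.\<close>
    have "open {y. \<bar>x \<bullet> y\<bar> < norm x * norm y}"
      by (intro open_Collect_less continuous_intros)
    from eventually_translate_in_open[OF this, of y "axis l 1"]
    have "\<forall>\<^sub>F t in nhds 0. \<bar>x \<bullet> (y + t *\<^sub>R axis l 1)\<bar> < norm x * norm (y + t *\<^sub>R axis l 1)"
      using xy by simp
    then show "\<forall>\<^sub>F t in nhds 0. (\<Sum>k\<in>UNIV. partial_x k L x (y + t *\<^sub>R axis l 1)
        * (y + t *\<^sub>R axis l 1) $ k) = A (y + t *\<^sub>R axis l 1)"
      by eventually_elim (rule A)
  qed simp
  ultimately have A_y: "(\<Sum>k\<in>UNIV. partial_y l (partial_x k L) x y * y $ k) + partial_x l L x y
      = deriv (\<lambda>t. A (y + t *\<^sub>R axis l 1)) 0"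
    by (simp only:)
  define u where "u = norm y"
  \<comment> \<open>The derivative of \<open>s\<close> in the direction \<open>y $ l\<close> is
    \<open>w / u\<close>.\<close>
  define w where "w = x $ l - s * y $ l / u"
  define p a b c d where "p = \<psi> r s" and "a = partial_r \<psi> r s" and "b = partial_s \<psi> r s"
    and "c = partial_s (partial_r \<psi>) r s" and "d = partial_s (partial_s \<psi>) r s"
  \<comment> \<open>The first summand differentiates the factor \<open>2 * u ^ 3\<close>, the second
    the part depending on \<open>s\<close>.\<close>
  have "((\<lambda>t. A (y + t *\<^sub>R axis l 1)) has_real_derivative
      6 * u * y $ l * (p * (s * a / r + b))
      + 2 * u\<^sup>2 * w * (b * (s * a / r + b) + p * (a / r + s * c / r + d))) (at 0)"
  proof -
    define U where "U t = norm (y + t *\<^sub>R axis l 1)" for t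
    define S where "S t = \<sigma> (y + t *\<^sub>R axis l 1)" for t
    have u: "u \<noteq> 0" "U 0 = u" "S 0 = s" "r \<noteq> 0"
      using nz by (simp_all add: u_def U_def S_def s_def \<sigma>_def r_def)
    have dU: "(U has_real_derivative y $ l / u) (at 0)"
      unfolding U_def u_def by (rule norm_line_has_derivative[OF nz(2)])
    have "((\<lambda>t. x \<bullet> (y + t *\<^sub>R axis l 1)) has_real_derivative x $ l) (at 0)"
      by (auto intro!: derivative_eq_intros simp: inner_add_right inner_axis)
    from DERIV_divide[OF this dU]
    have "(S has_real_derivative (x $ l * u - x \<bullet> y * (y $ l / u)) / (u * u)) (at 0)"
      using u by (simp add: S_def[abs_def] \<sigma>_def U_def[symmetric])
    moreover have "(x $ l * u - x \<bullet> y * (y $ l / u)) / (u * u) = w / u"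
      using u by (simp add: w_def s_def u_def field_simps)
    ultimately have dS: "(S has_real_derivative w / u) (at 0)" by simp
    have s: "\<bar>s\<bar> < norm x" using nz(3) by (simp add: s_def)
    note C2 = profile_C2[OF n \<Omega> F x s, folded \<psi>_def r_def]
    have "((\<lambda>t. (r, t)) has_derivative (\<lambda>t. (0, t))) (at s)"
      by (auto intro!: derivative_eq_intros)
    from has_derivative_compose[OF this C2(1)]
    have "((\<lambda>t. \<psi> r t) has_real_derivative b) (at (S 0))"
      using u(3) by (simp add: has_field_derivative_def b_def \<psi>_def)
    from DERIV_chain2[where g = S, OF this dS]
    have dp: "((\<lambda>t. \<psi> r (S t)) has_real_derivative b * (w / u)) (at 0)" .
    have da: "((\<lambda>t. partial_r \<psi> r (S t)) has_real_derivative c * (w / u)) (at 0)"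
      using C2(2) u(3) by (intro DERIV_chain2[where g = S, OF _ dS]) (simp add: c_def)
    have db: "((\<lambda>t. partial_s \<psi> r (S t)) has_real_derivative d * (w / u)) (at 0)"
      using C2(3) u(3) by (intro DERIV_chain2[where g = S, OF _ dS]) (simp add: d_def)
    note d = DERIV_mult[OF DERIV_cmult[OF DERIV_power[OF dU, of 3], of 2]
        DERIV_mult[OF dp DERIV_add[OF DERIV_cdivide[OF DERIV_mult[OF dS da], of r] db]]]
    have "((\<lambda>t. 2 * U t ^ 3 * (\<psi> r (S t) * (S t * partial_r \<psi> r (S t) / r + partial_s \<psi> r (S t))))
      has_real_derivative 6 * u * y $ l * (p * (s * a / r + b))
      + 2 * u\<^sup>2 * w * (b * (s * a / r + b) + p * (a / r + s * c / r + d))) (at 0)"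
    proof (rule DERIV_cong[OF d], unfold u(2,3) p_def[symmetric] a_def[symmetric] b_def[symmetric])
      show "2 * (real 3 * (y $ l / u * u ^ (3 - Suc 0))) * (p * (s * a / r + b)) +
          (b * (w / u) * (s * a / r + b) + ((w / u * a + c * (w / u) * s) / r + d * (w / u)) * p)
            * (2 * u ^ 3)
        = 6 * u * y $ l * (p * (s * a / r + b))
          + 2 * u\<^sup>2 * w * (b * (s * a / r + b) + p * (a / r + s * c / r + d))"
        using u(1,4) by (simp add: field_simps power2_eq_square power3_eq_cube)
    qed
    then show ?thesis by (simp only: A_def U_def S_def)
  qed
  from DERIV_imp_deriv[OF this]
  have sum: "(\<Sum>k\<in>UNIV. partial_y l (partial_x k L) x y * y $ k) + partial_x l L x y
    = 6 * u * y $ l * (p * (s * a / r + b))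
      + 2 * u\<^sup>2 * w * (b * (s * a / r + b) + p * (a / r + s * c / r + d))"
    unfolding A_y .
  \<comment> \<open>Once \<open>x $ l\<close> is split this way, the terms in \<open>y $ l\<close>
    cancel against the first summand of the derivative of \<open>A\<close>, and \<open>w\<close>
    factors out of the rest.\<close>
  have "\<sigma> y = s" "x $ l = w + s * y $ l / u" by (simp_all add: \<sigma>_def s_def w_def)
  with L_x[OF xy] have L_xl:
    "partial_x l L x y = 2 * u\<^sup>2 * p * (a * ((w + s * y $ l / u) / r) + b * (y $ l / u))"
    by (simp only: u_def p_def a_def b_def)
  have "(\<Sum>k\<in>UNIV. partial_y l (partial_x k L) x y * y $ k) - 2 * partial_x l L x y
    = (\<Sum>k\<in>UNIV. partial_y l (partial_x k L) x y * y $ k) + partial_x l L x y - 3 * partial_x l L x y"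
    by simp
  also have "\<dots> = 2 * u\<^sup>2 / r * w * (s * (a * b + p * c) + r * (b\<^sup>2 + p * d) - 2 * p * a)"
  proof -
    have "u \<noteq> 0" "r \<noteq> 0" using nz by (simp_all add: u_def r_def)
    then show ?thesis
      unfolding sum unfolding L_xl by (simp add: field_simps power2_eq_square)
  qed
  finally have "(\<Sum>k\<in>UNIV. partial_y l (partial_x k L) x y * y $ k) - 2 * partial_x l L x y
    = 2 * u\<^sup>2 / r * w * (s * (a * b + p * c) + r * (b\<^sup>2 + p * d) - 2 * p * a)" .
  then show ?thesis
    by (simp only: u_def r_def w_def p_def a_def b_def c_def d_def)
qed

text \<open>In the equality case \<open>x\<close> is a multiple of \<open>y\<close>, possibly zero.
  Moving \<open>x\<close> orthogonally to \<open>y\<close> keeps the inner product and strictly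
  increases the norm.\<close>

lemma exists_strict_cauchy_schwarz_direction:
  fixes x y :: "real^'n::finite"
  assumes n: "CARD('n) \<ge> 2" and "y \<noteq> 0" and "\<not> \<bar>x \<bullet> y\<bar> < norm x * norm y"
  shows "\<exists>w. \<forall>t. t \<noteq> 0 \<longrightarrow> \<bar>(x + t *\<^sub>R w) \<bullet> y\<bar> < norm (x + t *\<^sub>R w) * norm y"
proof -
  obtain w where w: "norm w = 1" "y \<bullet> w = 0"
    using orthonormal_frame_dim2[OF n \<open>y \<noteq> 0\<close>] .
  have "\<bar>y \<bullet> x\<bar> = norm y * norm x"
    using assms(3) Cauchy_Schwarz_ineq2[of x y] by (simp add: inner_commute mult.commute)
  then have "collinear {0, y, x}"
    by (rule norm_cauchy_schwarz_equal[THEN iffD1])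
  then have "y = 0 \<or> x = 0 \<or> (\<exists>c. x = c *\<^sub>R y)"
    by (rule collinear_lemma[THEN iffD1])
  then obtain c where c: "x = c *\<^sub>R y"
    using \<open>y \<noteq> 0\<close> scaleR_zero_left[of y] by metis
  show ?thesis
  proof (intro exI allI impI)
    fix t :: real assume "t \<noteq> 0"
    have "orthogonal x (t *\<^sub>R w)"
      using w(2) by (simp add: c orthogonal_def)
    then have "(norm (x + t *\<^sub>R w))\<^sup>2 = (norm x)\<^sup>2 + t\<^sup>2"
      using norm_add_Pythagorean[of x "t *\<^sub>R w"] w(1) by simp
    moreover have "t\<^sup>2 > 0" using \<open>t \<noteq> 0\<close> by simp
    ultimately have "(norm x)\<^sup>2 < (norm (x + t *\<^sub>R w))\<^sup>2" by linarith
    then have "norm x < norm (x + t *\<^sub>R w)"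
      by (rule power2_less_imp_less) (rule norm_ge_zero)
    then have "norm x * norm y < norm (x + t *\<^sub>R w) * norm y"
      using \<open>y \<noteq> 0\<close> by (intro mult_strict_right_mono) simp_all
    moreover have "(x + t *\<^sub>R w) \<bullet> y = x \<bullet> y"
      using w(2) by (simp add: inner_add_left inner_commute[of w y])
    moreover note Cauchy_Schwarz_ineq2[of x y]
    ultimately show "\<bar>(x + t *\<^sub>R w) \<bullet> y\<bar> < norm (x + t *\<^sub>R w) * norm y"
      by linarith
  qed
qed

theorem theorem3p2:
  fixes \<Omega> :: "(real^'n::finite) set"
    and F :: "real^'n \<Rightarrow> real^'n \<Rightarrow> real"
    and \<phi> :: "real \<Rightarrow> real \<Rightarrow> real \<Rightarrow> real"
  assumes "CARD('n) \<ge> 2"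
    and "open \<Omega>" and "convex \<Omega>" and "\<Omega> \<noteq> {}"
    and "finsler_metric \<Omega> F"
    and "spherically_symmetric \<Omega> \<phi> F"
  shows "locally_dually_flat \<Omega> F \<longleftrightarrow>
    (\<forall>x\<in>\<Omega>. \<forall>y. \<bar>x \<bullet> y\<bar> < norm x * norm y \<longrightarrow>
       dual_flatness_equation (\<lambda>r s. \<phi> r 1 s) (norm x) (x \<bullet> y / norm y))"
proof -
  define L where "L = (\<lambda>x y. (F x y)\<^sup>2)"
  define G where "G l x y = (\<Sum>k\<in>UNIV. partial_y l (partial_x k L) x y * y $ k) - 2 * partial_x l L x y"
    for l x y
  note defect = flatness_defect_spherical[OF assms(1,2,5,6), folded L_def, folded G_def]
  have flat: "locally_dually_flat \<Omega> F \<longleftrightarrow> (\<forall>x\<in>\<Omega>. \<forall>y. y \<noteq> 0 \<longrightarrow> (\<forall>l. G l x y = 0))"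
    unfolding locally_dually_flat_iff[OF assms(2,5)] G_def L_def by simp
  have equation: "(\<forall>l. G l x y = 0) \<longleftrightarrow>
      dual_flatness_equation (\<lambda>r s. \<phi> r 1 s) (norm x) (x \<bullet> y / norm y)"
    if x: "x \<in> \<Omega>" and xy: "\<bar>x \<bullet> y\<bar> < norm x * norm y" for x y
  proof -
    note nz = strict_cauchy_schwarz_bounds[OF xy]
    \<comment> \<open>These are the components of the part of \<open>x\<close> orthogonal to
      \<open>y\<close>. One nonzero component suffices to recover the scalar equation from the
      vanishing defect.\<close>
    have "\<exists>l. x $ l - x \<bullet> y / norm y * y $ l / norm y \<noteq> 0"
    proof (rule ccontr)
      assume "\<not> ?thesis"
      then have "x = (x \<bullet> y / norm y / norm y) *\<^sub>R y"
        by (simp add: vec_eq_iff)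
      then obtain c where c: "x = c *\<^sub>R y" ..
      then have "\<bar>x \<bullet> y\<bar> = norm x * norm y"
        by (simp add: abs_mult dot_square_norm power2_eq_square)
      with xy show False by simp
    qed
    then obtain l where l: "x $ l - x \<bullet> y / norm y * y $ l / norm y \<noteq> 0" ..
    have K: "2 * (norm y)\<^sup>2 / norm x \<noteq> 0" using nz by simp
    show ?thesis
    proof
      assume "\<forall>l. G l x y = 0"
      then have "G l x y = 0" ..
      then show "dual_flatness_equation (\<lambda>r s. \<phi> r 1 s) (norm x) (x \<bullet> y / norm y)"
        unfolding dual_flatness_equation_def defect[OF x xy]
        using mult_eq_0_iff K l by blast
    next
      assume "dual_flatness_equation (\<lambda>r s. \<phi> r 1 s) (norm x) (x \<bullet> y / norm y)"
      then show "\<forall>l. G l x y = 0"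
        unfolding dual_flatness_equation_def defect[OF x xy] by (simp only: mult_zero_right) blast
    qed
  qed
  \<comment> \<open>For a dependent pair, \<open>G l\<close> vanishes at
    \<open>x + t *\<^sub>R w\<close> for all small \<open>t\<close> other than 0, and continuity on
    the slit bundle carries this to \<open>t = 0\<close>.\<close>
  have dense: "G l x y = 0"
    if indep: "\<And>x y. x \<in> \<Omega> \<Longrightarrow> \<bar>x \<bullet> y\<bar> < norm x * norm y \<Longrightarrow> G l x y = 0"
      and x: "x \<in> \<Omega>" and y: "y \<noteq> 0" for l x y
  proof (cases "\<bar>x \<bullet> y\<bar> < norm x * norm y")
    case False
    from exists_strict_cauchy_schwarz_direction[OF assms(1) y False]
    obtain w where w: "\<forall>t. t \<noteq> 0 \<longrightarrow> \<bar>(x + t *\<^sub>R w) \<bullet> y\<bar> < norm (x + t *\<^sub>R w) * norm y" ..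
    have CL: "Cinf_on (\<Omega> \<times> (UNIV - {0})) (\<lambda>(x, y). L x y)"
      unfolding L_def by (rule finsler_metric_square(1)[OF assms(2,5)])
    have cont: "isCont (\<lambda>t. K (x + t *\<^sub>R w) y) 0"
      if "Cinf_on (\<Omega> \<times> (UNIV - {0})) (\<lambda>(x, y). K x y)" for K :: "real^'n \<Rightarrow> real^'n \<Rightarrow> real"
    proof -
      have "continuous_on (\<Omega> \<times> (UNIV - {0})) (\<lambda>(x, y). K x y)"
        by (rule Cinf_onD(2)[OF that])
      then have "\<forall>z\<in>\<Omega> \<times> (UNIV - {0}). isCont (\<lambda>(x, y). K x y) z"
        by (rule continuous_on_eq_continuous_at[OF open_slit[OF assms(2)], THEN iffD1])
      from bspec[OF this, of "(x, y)"]
      have 1: "isCont (\<lambda>(x, y). K x y) (x + 0 *\<^sub>R w, y)"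
        using x y by (simp only: scaleR_zero_left add_0_right mem_Times_iff) simp
      have 2: "isCont (\<lambda>t. (x + t *\<^sub>R w, y)) (0::real)"
        by (intro continuous_intros)
      from isCont_o2[where g = "\<lambda>(x, y). K x y", OF 2 1] show ?thesis
        by (simp only: prod.case)
    qed
    note Cx = Cinf_on_partial_x[OF assms(2) CL]
    have "isCont (\<lambda>t. G l (x + t *\<^sub>R w) y) 0"
      unfolding G_def
      by (intro continuous_intros cont[OF Cx] cont[OF Cinf_on_partial_y[OF assms(2) Cx]])
    then have "((\<lambda>t. G l (x + t *\<^sub>R w) y) \<longlongrightarrow> G l x y) (at 0)"
      by (simp add: isCont_def)
    moreover have "((\<lambda>t. G l (x + t *\<^sub>R w) y) \<longlongrightarrow> 0) (at 0)"
    proof (rule tendsto_eventually)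
      have "\<forall>\<^sub>F t in at 0. x + t *\<^sub>R w \<in> \<Omega>"
        using eventually_translate_in_open[OF assms(2) x, of w]
        unfolding eventually_at_filter by (rule eventually_mono) simp
      moreover have "\<forall>\<^sub>F t in at (0::real). t \<noteq> 0"
        by (simp add: eventually_at_filter)
      ultimately show "\<forall>\<^sub>F t in at 0. G l (x + t *\<^sub>R w) y = 0"
        by eventually_elim (rule indep[OF _ w[rule_format]])
    qed
    ultimately show ?thesis
      by (rule tendsto_unique[OF at_neq_bot])
  qed (rule indep[OF x])
  show ?thesis
    unfolding flat
  proof (intro iffI ballI allI impI)
    fix x y :: "real^'n"
    assume *: "\<forall>x\<in>\<Omega>. \<forall>y. y \<noteq> 0 \<longrightarrow> (\<forall>l. G l x y = 0)"
      and x: "x \<in> \<Omega>" and xy: "\<bar>x \<bullet> y\<bar> < norm x * norm y"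
    from * x strict_cauchy_schwarz_bounds(2)[OF xy] have "\<forall>l. G l x y = 0" by blast
    then show "dual_flatness_equation (\<lambda>r s. \<phi> r 1 s) (norm x) (x \<bullet> y / norm y)"
      using equation[OF x xy] by (rule rev_iffD1)
  next
    fix x y :: "real^'n" and l
    assume *: "\<forall>x\<in>\<Omega>. \<forall>y. \<bar>x \<bullet> y\<bar> < norm x * norm y \<longrightarrow>
        dual_flatness_equation (\<lambda>r s. \<phi> r 1 s) (norm x) (x \<bullet> y / norm y)"
      and x: "x \<in> \<Omega>" and y: "y \<noteq> 0"
    show "G l x y = 0"
    proof (rule dense[OF _ x y])
      fix x y :: "real^'n" assume x: "x \<in> \<Omega>" and xy: "\<bar>x \<bullet> y\<bar> < norm x * norm y"
      have "\<forall>l. G l x y = 0"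
        using *[rule_format, OF x xy] equation[OF x xy] by (rule rev_iffD2)
      then show "G l x y = 0" ..
    qed
  qed
qed

end
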